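(* Let $m,n$ be non-zero integers, and let $\overline{\langle a\rangle}$ denote the closure in $G_{m,n}$ of the image of $\langle a\rangle$. The compact open subgroup $\overline{\langle a\rangle}$ of $G_{m,n}$ has an open subgroup $V$ such that, as topological groups, $$V\cong\prod\left\{(\mathbb{Z}_p,+)\mid p\text{ is a prime divisor of }\operatorname{lcm}(m,n)/m\text{ or of }\operatorname{lcm}(m,n)/n\right\}.$$ Moreover, the quotient $\overline{\langle a\rangle}/V$ is a finite cyclic group with order dividing $\gcd(m,n)$.
   Context: $\mathbb{Z}_p$ denotes the $p$-adic integers; an empty product is the trivial group. For non-zero integers $m,n$, $\mathrm{BS}(m,n)=\langle a,t\mid ta^mt^{-1}=a^n\rangle$. Let $\pi:\mathrm{BS}(m,n)\to \mathrm{Sym}(\mathrm{BS}(m,n)/\langle a\rangle)$ be the action by left multiplication on left cosets of $\langle a\rangle$. $\mathrm{Sym}(\mathrm{BS}(m,n)/\langle a\rangle)$ has the topology of pointwise convergence, with basis the sets $\mathcal N(x,F)=\{y\mid y(c)=x(c)\ \forall c\in F\}$, $F$ a finite set of cosets. $G_{m,n}$ is the closure of the image of $\pi$ with the subspace topology; it is a totally disconnected locally compact group, and $\overline{\langle a\rangle}$, the closure of $\pi(\langle a\rangle)$, is a compact open subgroup of it. *)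

theory Defs
  imports
    "HOL-Analysis.Analysis"
    "HOL-Algebra.Bij"
    "HOL-Algebra.Left_Coset"
    "HOL-Algebra.Generated_Groups"
    "HOL-Algebra.Elementary_Groups"
    "HOL-Algebra.Product_Groups"
begin

section \<open>Groups given by generators and relations\<close>

text \<open>A letter \<open>(x, False)\<close> stands for the generator \<open>x\<close> and \<open>(x, True)\<close> for its formal inverse.\<close>

type_synonym 'x gword = "('x \<times> bool) list"

text \<open>A pair \<open>(u, v)\<close> in \<open>R\<close> is the relation \<open>u = v\<close>.\<close>

inductive pres_eq :: "('x gword \<times> 'x gword) set \<Rightarrow> 'x gword \<Rightarrow> 'x gword \<Rightarrow> bool"
  for R where
  refl: "pres_eq R u u"
| sym: "pres_eq R u v \<Longrightarrow> pres_eq R v u"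
| trans: "pres_eq R u v \<Longrightarrow> pres_eq R v w \<Longrightarrow> pres_eq R u w"
| cancel: "pres_eq R (p @ [(x, b), (x, \<not> b)] @ q) (p @ q)"
| rel: "(u, v) \<in> R \<Longrightarrow> pres_eq R (p @ u @ q) (p @ v @ q)"

definition pres_class :: "('x gword \<times> 'x gword) set \<Rightarrow> 'x gword \<Rightarrow> 'x gword set" where
  "pres_class R u = {v. pres_eq R u v}"

definition presented_group :: "('x gword \<times> 'x gword) set \<Rightarrow> 'x gword set monoid" where
  "presented_group R =
    \<lparr>carrier = range (pres_class R),
     monoid.mult = (\<lambda>A B. \<Union>u\<in>A. \<Union>v\<in>B. pres_class R (u @ v)),
     one = pres_class R []\<rparr>"

lemma pres_eq_ctxt: "pres_eq R u v \<Longrightarrow> pres_eq R (p @ u @ q) (p @ v @ q)"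
proof (induction rule: pres_eq.induct)
  case (cancel p' x b q')
  show ?case
    using pres_eq.cancel[of R "p @ p'" x b "q' @ q"] by simp
next
  case (rel u v p' q')
  then show ?case
    using pres_eq.rel[of u v R "p @ p'" "q' @ q"] by simp
next
  case (trans u v w)
  then show ?case by (blast intro: pres_eq.trans)
qed (simp_all add: pres_eq.refl pres_eq.sym)

lemma pres_eq_append: "pres_eq R u u' \<Longrightarrow> pres_eq R v v' \<Longrightarrow> pres_eq R (u @ v) (u' @ v')"
  using pres_eq_ctxt[of R u u' "[]" v] pres_eq_ctxt[of R v v' u' "[]"]
    pres_eq.trans[of R "u @ v" "u' @ v" "u' @ v'"]
  by simp

lemma pres_class_eq_iff: "pres_class R u = pres_class R v \<longleftrightarrow> pres_eq R u v"
  unfolding pres_class_def set_eq_iff mem_Collect_eq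
  by (meson pres_eq.refl pres_eq.sym pres_eq.trans)

lemma carrier_presented_group: "carrier (presented_group R) = range (pres_class R)"
  by (simp add: presented_group_def)

lemma one_presented_group: "\<one>\<^bsub>presented_group R\<^esub> = pres_class R []"
  by (simp add: presented_group_def)

lemma mult_presented_group:
  "pres_class R u \<otimes>\<^bsub>presented_group R\<^esub> pres_class R v = pres_class R (u @ v)"
proof -
  have "pres_class R (u' @ v') = pres_class R (u @ v)"
    if "u' \<in> pres_class R u" "v' \<in> pres_class R v" for u' v'
    using that pres_eq.sym[OF pres_eq_append, of R u u' v v']
    by (simp add: pres_class_eq_iff) (simp add: pres_class_def)
  then have "(\<Union>u'\<in>pres_class R u. \<Union>v'\<in>pres_class R v. pres_class R (u' @ v')) =
      (\<Union>u'\<in>pres_class R u. \<Union>v'\<in>pres_class R v. pres_class R (u @ v))"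
    by (intro SUP_cong) simp_all
  moreover have "pres_class R w \<noteq> {}" for w
    using pres_eq.refl[of R w] by (auto simp: pres_class_def simp del: ex_in_conv)
  ultimately show ?thesis
    by (simp add: presented_group_def)
qed

lemma pres_eq_cancel_inverse:
  "pres_eq R (rev (map (\<lambda>(x, b). (x, \<not> b)) u) @ u) []"
proof (induction u)
  case Nil
  then show ?case by (simp add: pres_eq.refl)
next
  case (Cons l u)
  obtain x b where l: "l = (x, b)" by fastforce
  have "pres_eq R (rev (map (\<lambda>(x, b). (x, \<not> b)) (l # u)) @ l # u)
      (rev (map (\<lambda>(x, b). (x, \<not> b)) u) @ u)"
    using pres_eq.cancel[of R "rev (map (\<lambda>(x, b). (x, \<not> b)) u)" x "\<not> b" u]
    by (simp add: l)
  then show ?case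
    using Cons.IH by (rule pres_eq.trans)
qed

lemma group_presented_group: "group (presented_group R)"
proof (rule groupI)
  fix A assume "A \<in> carrier (presented_group R)"
  then obtain u where "A = pres_class R u"
    by (auto simp: carrier_presented_group)
  then show "\<exists>B\<in>carrier (presented_group R). B \<otimes>\<^bsub>presented_group R\<^esub> A = \<one>\<^bsub>presented_group R\<^esub>"
    by (intro bexI[of _ "pres_class R (rev (map (\<lambda>(x, b). (x, \<not> b)) u))"])
       (auto simp: carrier_presented_group one_presented_group mult_presented_group
          pres_class_eq_iff pres_eq_cancel_inverse)
qed (auto simp: carrier_presented_group one_presented_group mult_presented_group)


section \<open>Baumslag--Solitar groups\<close>

datatype bs_gen = gen_a | gen_t

definition word_pow :: "'x \<Rightarrow> int \<Rightarrow> 'x gword" where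
  "word_pow x k = replicate (nat \<bar>k\<bar>) (x, k < 0)"

definition BS_rels :: "int \<Rightarrow> int \<Rightarrow> (bs_gen gword \<times> bs_gen gword) set" where
  "BS_rels m n = {([(gen_t, False)] @ word_pow gen_a m @ [(gen_t, True)], word_pow gen_a n)}"

definition BS :: "int \<Rightarrow> int \<Rightarrow> bs_gen gword set monoid" where
  "BS m n = presented_group (BS_rels m n)"

definition BS_a :: "int \<Rightarrow> int \<Rightarrow> bs_gen gword set" where
  "BS_a m n = pres_class (BS_rels m n) [(gen_a, False)]"

definition BS_t :: "int \<Rightarrow> int \<Rightarrow> bs_gen gword set" where
  "BS_t m n = pres_class (BS_rels m n) [(gen_t, False)]"

lemma group_BS: "group (BS m n)"
  by (simp add: BS_def group_presented_group)

lemma BS_a_closed: "BS_a m n \<in> carrier (BS m n)"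
  and BS_t_closed: "BS_t m n \<in> carrier (BS m n)"
  by (simp_all add: BS_def BS_a_def BS_t_def carrier_presented_group)

lemma pres_class_inv_gen:
  "inv\<^bsub>presented_group R\<^esub> (pres_class R [(x, b)]) = pres_class R [(x, \<not> b)]"
  using pres_eq.cancel[of R "[]" x "\<not> b" "[]"]
  by (intro group.inv_equality[OF group_presented_group])
     (auto simp: carrier_presented_group one_presented_group mult_presented_group pres_class_eq_iff)

lemma pres_class_replicate:
  "pres_class R (replicate k l) = pres_class R [l] [^]\<^bsub>presented_group R\<^esub> k"
proof (induction k)
  case (Suc k)
  have "pres_class R (replicate (Suc k) l) = pres_class R (replicate k l @ [l])"
    by (simp add: replicate_append_same)
  then show ?case
    using Suc by (simp flip: mult_presented_group)
qed (simp add: one_presented_group)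

lemma pres_class_word_pow:
  "pres_class R (word_pow x k) = pres_class R [(x, False)] [^]\<^bsub>presented_group R\<^esub> k"
proof -
  interpret group "presented_group R" by (rule group_presented_group)
  have c: "pres_class R [(x, b)] \<in> carrier (presented_group R)" for b
    by (simp add: carrier_presented_group)
  show ?thesis
  proof (cases "k < 0")
    case True
    have "pres_class R (word_pow x k) = pres_class R [(x, True)] [^]\<^bsub>presented_group R\<^esub> nat (- k)"
      using True by (simp add: word_pow_def pres_class_replicate)
    also have "pres_class R [(x, True)] = inv\<^bsub>presented_group R\<^esub> pres_class R [(x, False)]"
      by (simp add: pres_class_inv_gen)
    also have "(inv\<^bsub>presented_group R\<^esub> pres_class R [(x, False)]) [^]\<^bsub>presented_group R\<^esub> nat (- k) =
        inv\<^bsub>presented_group R\<^esub> (pres_class R [(x, False)] [^]\<^bsub>presented_group R\<^esub> nat (- k))"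
      by (rule nat_pow_inv[OF c])
    also have "\<dots> = pres_class R [(x, False)] [^]\<^bsub>presented_group R\<^esub> k"
      unfolding int_pow_def2 using True by (simp only: if_True)
    finally show ?thesis .
  next
    case False
    then have "pres_class R (word_pow x k) = pres_class R [(x, False)] [^]\<^bsub>presented_group R\<^esub> nat k"
      by (simp add: word_pow_def pres_class_replicate)
    then show ?thesis
      unfolding int_pow_def2 using False by (simp only: if_False)
  qed
qed

lemma BS_relation:
  "BS_t m n \<otimes>\<^bsub>BS m n\<^esub> BS_a m n [^]\<^bsub>BS m n\<^esub> m \<otimes>\<^bsub>BS m n\<^esub> inv\<^bsub>BS m n\<^esub> BS_t m n
    = BS_a m n [^]\<^bsub>BS m n\<^esub> n"
  using pres_eq.rel[of _ _ "BS_rels m n" "[]" "[]"]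
  by (simp add: BS_def BS_a_def BS_t_def pres_class_inv_gen mult_presented_group
      pres_class_eq_iff BS_rels_def flip: pres_class_word_pow)


section \<open>The closure of the action on the cosets of the subgroup generated by a\<close>

definition BS_A :: "int \<Rightarrow> int \<Rightarrow> bs_gen gword set set" where
  "BS_A m n = generate (BS m n) {BS_a m n}"

definition BS_cosets :: "int \<Rightarrow> int \<Rightarrow> bs_gen gword set set set" where
  "BS_cosets m n = lcosets\<^bsub>BS m n\<^esub> (BS_A m n)"

definition BS_action ::
    "int \<Rightarrow> int \<Rightarrow> bs_gen gword set \<Rightarrow> bs_gen gword set set \<Rightarrow> bs_gen gword set set" where
  "BS_action m n g = (\<lambda>c\<in>BS_cosets m n. g <#\<^bsub>BS m n\<^esub> c)"

text \<open>The topology of pointwise convergence on \<open>Bij S\<close>. The points of the product are the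
  extensional maps from \<open>S\<close> to \<open>S\<close>, which is also how \<open>Bij S\<close> represents permutations.\<close>

definition sym_topology :: "'a set \<Rightarrow> ('a \<Rightarrow> 'a) topology" where
  "sym_topology S = subtopology (product_topology (\<lambda>_. discrete_topology S) S) (Bij S)"

lemma Bij_subset_PiE: "Bij S \<subseteq> (\<Pi>\<^sub>E c\<in>S. S)"
  by (auto simp: Bij_def bij_betw_def PiE_def)

lemma topspace_sym_topology: "topspace (sym_topology S) = Bij S"
  using Bij_subset_PiE by (auto simp: sym_topology_def)

lemma openin_sym_topology_iff:
  "openin (sym_topology S) U \<longleftrightarrow>
    U \<subseteq> Bij S \<and>
    (\<forall>x\<in>U. \<exists>F. finite F \<and> F \<subseteq> S \<and> {y \<in> Bij S. \<forall>c\<in>F. y c = x c} \<subseteq> U)"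
  (is "?L \<longleftrightarrow> ?R")
proof
  assume ?L
  then obtain W where W: "openin (product_topology (\<lambda>_. discrete_topology S) S) W"
    and U: "U = W \<inter> Bij S"
    by (auto simp: sym_topology_def openin_subtopology)
  have "\<exists>F. finite F \<and> F \<subseteq> S \<and> {y \<in> Bij S. \<forall>c\<in>F. y c = x c} \<subseteq> U" if "x \<in> U" for x
  proof -
    have "x \<in> W" using that U by simp
    then obtain V where V: "finite {c \<in> S. V c \<noteq> S}" "x \<in> Pi\<^sub>E S V" "Pi\<^sub>E S V \<subseteq> W"
      using W unfolding openin_product_topology_alt by fastforce
    have "y \<in> Pi\<^sub>E S V" if y: "y \<in> Bij S" "\<forall>c\<in>{c \<in> S. V c \<noteq> S}. y c = x c" for y
    proof -
      have "y c \<in> V c" if "c \<in> S" for c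
        using y V(2) that Bij_imp_funcset[OF y(1)] by (cases "V c = S") auto
      then show ?thesis
        using Bij_imp_extensional[OF y(1)] by (auto simp: PiE_def)
    qed
    then show ?thesis
      using V U by (intro exI[of _ "{c \<in> S. V c \<noteq> S}"]) blast
  qed
  then show ?R using U by auto
next
  assume R: ?R
  show ?L
  proof (subst openin_subopen, intro ballI)
    fix x assume x: "x \<in> U"
    then obtain F where F: "finite F" "F \<subseteq> S" "{y \<in> Bij S. \<forall>c\<in>F. y c = x c} \<subseteq> U"
      using R by blast
    let ?V = "\<lambda>c. if c \<in> F then {x c} else S"
    have xB: "x \<in> Bij S" using x R by auto
    have "openin (product_topology (\<lambda>_. discrete_topology S) S) (Pi\<^sub>E S ?V)"
      using F Bij_imp_funcset[OF xB]
      by (auto simp: openin_PiE_gen intro: finite_subset[of _ F])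
    then have "openin (sym_topology S) (Pi\<^sub>E S ?V \<inter> Bij S)"
      by (auto simp: sym_topology_def openin_subtopology)
    moreover have "x \<in> Pi\<^sub>E S ?V \<inter> Bij S"
      using xB Bij_subset_PiE[of S] by (auto simp: PiE_def Pi_def)
    moreover have "Pi\<^sub>E S ?V \<inter> Bij S \<subseteq> U"
    proof
      fix y assume y: "y \<in> Pi\<^sub>E S ?V \<inter> Bij S"
      have "y c = x c" if "c \<in> F" for c
        using y that F(2) by (auto simp: PiE_def Pi_def split: if_splits)
      then show "y \<in> U" using y F by blast
    qed
    ultimately show "\<exists>T. openin (sym_topology S) T \<and> x \<in> T \<and> T \<subseteq> U" by blast
  qed
qed

lemma in_closure_sym_topology_iff:
  assumes "T \<subseteq> Bij S"
  shows "x \<in> Abstract_Topology.closure_of (sym_topology S) T \<longleftrightarrow>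
    x \<in> Bij S \<and> (\<forall>F. finite F \<and> F \<subseteq> S \<longrightarrow> (\<exists>h\<in>T. \<forall>c\<in>F. h c = x c))"
  (is "?L \<longleftrightarrow> ?R")
proof
  assume L: ?L
  have x: "x \<in> Bij S"
    using L by (simp add: in_closure_of topspace_sym_topology)
  have "\<exists>h\<in>T. \<forall>c\<in>F. h c = x c" if F: "finite F" "F \<subseteq> S" for F
  proof -
    have "openin (sym_topology S) {y \<in> Bij S. \<forall>c\<in>F. y c = x c}"
      unfolding openin_sym_topology_iff using F by (auto intro!: exI[of _ F])
    moreover have "x \<in> {y \<in> Bij S. \<forall>c\<in>F. y c = x c}" using x by simp
    ultimately obtain h where "h \<in> T" "h \<in> {y \<in> Bij S. \<forall>c\<in>F. y c = x c}"
      using L unfolding in_closure_of by meson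
    then show ?thesis by blast
  qed
  with x show ?R by blast
next
  assume R: ?R
  show ?L
    unfolding in_closure_of topspace_sym_topology
  proof (intro conjI allI impI)
    fix U assume U: "x \<in> U \<and> openin (sym_topology S) U"
    then obtain F where F: "finite F" "F \<subseteq> S" "{y \<in> Bij S. \<forall>c\<in>F. y c = x c} \<subseteq> U"
      unfolding openin_sym_topology_iff by blast
    then obtain h where "h \<in> T" "\<forall>c\<in>F. h c = x c" using R by blast
    moreover from this have "h \<in> U" using F(3) assms by auto
    ultimately show "\<exists>y. y \<in> T \<and> y \<in> U" by blast
  qed (use R in blast)
qed

lemma subgroup_closure_sym_topology:
  assumes H: "subgroup H (BijGroup S)"
  shows "subgroup (Abstract_Topology.closure_of (sym_topology S) H) (BijGroup S)"
proof -
  have sub: "H \<subseteq> Bij S"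
    using subgroup.subset[OF H] by (simp add: BijGroup_def)
  have m: "x \<otimes>\<^bsub>BijGroup S\<^esub> y = compose S x y" if "x \<in> Bij S" "y \<in> Bij S" for x y
    using that by (simp add: BijGroup_def)
  note cl = in_closure_sym_topology_iff[OF sub]
  show ?thesis
  proof
    show "Abstract_Topology.closure_of (sym_topology S) H \<subseteq> carrier (BijGroup S)"
      by (auto simp: cl BijGroup_def)
  next
    have "H \<subseteq> Abstract_Topology.closure_of (sym_topology S) H"
      using sub by (simp add: closure_of_subset topspace_sym_topology)
    then show "\<one>\<^bsub>BijGroup S\<^esub> \<in> Abstract_Topology.closure_of (sym_topology S) H"
      using subgroup.one_closed[OF H] by blast
  next
    fix x y
    assume x: "x \<in> Abstract_Topology.closure_of (sym_topology S) H"
      and y: "y \<in> Abstract_Topology.closure_of (sym_topology S) H"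
    have B: "x \<in> Bij S" "y \<in> Bij S" using x y by (simp_all add: cl)
    have "\<exists>h\<in>H. \<forall>c\<in>F. h c = compose S x y c" if F: "finite F" "F \<subseteq> S" for F
    proof -
      obtain k where k: "k \<in> H" "\<forall>c\<in>F. k c = y c" using y F cl by blast
      have "finite (y ` F)" "y ` F \<subseteq> S"
        using F Bij_imp_funcset[OF B(2)] by auto
      then obtain h where h: "h \<in> H" "\<forall>c\<in>y ` F. h c = x c" using x cl by blast
      have "h \<otimes>\<^bsub>BijGroup S\<^esub> k \<in> H" using h k H by (simp add: subgroup.m_closed)
      moreover have "h \<otimes>\<^bsub>BijGroup S\<^esub> k = compose S h k" using h k sub by (intro m) auto
      moreover have "compose S h k c = compose S x y c" if "c \<in> F" for c
        using that F h k by (auto simp: compose_def)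
      ultimately show ?thesis by metis
    qed
    then show "x \<otimes>\<^bsub>BijGroup S\<^esub> y \<in> Abstract_Topology.closure_of (sym_topology S) H"
      using B by (simp add: cl m compose_Bij)
  next
    fix x assume x: "x \<in> Abstract_Topology.closure_of (sym_topology S) H"
    have B: "x \<in> Bij S" using x by (simp add: cl)
    let ?i = "\<lambda>f. restrict (inv_into S f) S"
    have "\<exists>h\<in>H. \<forall>c\<in>F. h c = ?i x c" if F: "finite F" "F \<subseteq> S" for F
    proof -
      have bx: "bij_betw x S S" using B by (simp add: Bij_def)
      have "finite (inv_into S x ` F)" "inv_into S x ` F \<subseteq> S"
        using F bij_betw_imp_funcset[OF bij_betw_inv_into[OF bx]] by auto
      then obtain h where h: "h \<in> H" "\<forall>c\<in>inv_into S x ` F. h c = x c" using x cl by blast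
      have hB: "h \<in> Bij S" using h sub by blast
      then have bh: "bij_betw h S S" by (simp add: Bij_def)
      have "inv\<^bsub>BijGroup S\<^esub> h \<in> H" using h H by (simp add: subgroup.m_inv_closed)
      then have "?i h \<in> H" using hB by (simp add: inv_BijGroup)
      moreover have "?i h c = ?i x c" if c: "c \<in> F" for c
      proof -
        have cS: "c \<in> S" using c F by blast
        have d: "inv_into S x c \<in> S"
          using bij_betw_imp_funcset[OF bij_betw_inv_into[OF bx]] cS by blast
        have "h (inv_into S x c) = c"
          using h c bij_betw_inv_into_right[OF bx cS] by simp
        then have "inv_into S h c = inv_into S x c"
          using bij_betw_inv_into_left[OF bh d] by simp
        then show ?thesis using cS by simp
      qed
      ultimately show ?thesis by blast
    qed
    moreover have "?i x \<in> Bij S" by (rule restrict_inv_into_Bij[OF B])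
    ultimately have "?i x \<in> Abstract_Topology.closure_of (sym_topology S) H"
      unfolding cl by blast
    then show "inv\<^bsub>BijGroup S\<^esub> x \<in> Abstract_Topology.closure_of (sym_topology S) H"
      using inv_BijGroup[OF B] by simp
  qed
qed

lemma BS_A_subset: "BS_A m n \<subseteq> carrier (BS m n)"
  unfolding BS_A_def using BS_a_closed by (intro group.generate_incl[OF group_BS]) auto

lemma hom_BS_action: "BS_action m n \<in> hom (BS m n) (BijGroup (BS_cosets m n))"
proof -
  interpret group "BS m n" by (rule group_BS)
  let ?S = "BS_cosets m n"
  have cosets: "c \<in> ?S \<Longrightarrow> c \<subseteq> carrier (BS m n)" for c
    using BS_A_subset[of m n] l_coset_subset_G[of "BS_A m n"]
    by (auto simp: BS_cosets_def LCOSETS_def)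
  have act: "g <#\<^bsub>BS m n\<^esub> c \<in> ?S" if "g \<in> carrier (BS m n)" "c \<in> ?S" for g c
    using that BS_A_subset[of m n]
    by (fastforce simp: BS_cosets_def LCOSETS_def lcos_m_assoc)
  have assoc: "g <#\<^bsub>BS m n\<^esub> (h <#\<^bsub>BS m n\<^esub> c) = (g \<otimes>\<^bsub>BS m n\<^esub> h) <#\<^bsub>BS m n\<^esub> c"
    if "g \<in> carrier (BS m n)" "h \<in> carrier (BS m n)" "c \<in> ?S" for g h c
    using lcos_m_assoc[OF cosets[OF that(3)] that(1,2)] .
  have one: "\<one>\<^bsub>BS m n\<^esub> <#\<^bsub>BS m n\<^esub> c = c" if "c \<in> ?S" for c
    using lcos_mult_one[OF cosets[OF that]] .
  have bij: "BS_action m n g \<in> Bij ?S" if g: "g \<in> carrier (BS m n)" for g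
  proof -
    have "bij_betw (\<lambda>c. g <#\<^bsub>BS m n\<^esub> c) ?S ?S"
      using g by (intro bij_betw_byWitness[where f' = "\<lambda>c. inv\<^bsub>BS m n\<^esub> g <#\<^bsub>BS m n\<^esub> c"])
        (auto simp: assoc one act)
    then have "bij_betw (BS_action m n g) ?S ?S"
      by (rule bij_betw_cong[THEN iffD1, rotated]) (simp add: BS_action_def)
    then show ?thesis by (simp add: Bij_def BS_action_def)
  qed
  show ?thesis
  proof (rule homI)
    fix g h assume gh: "g \<in> carrier (BS m n)" "h \<in> carrier (BS m n)"
    have "BS_action m n (g \<otimes>\<^bsub>BS m n\<^esub> h) = compose ?S (BS_action m n g) (BS_action m n h)"
      using gh by (auto simp: BS_action_def compose_def fun_eq_iff assoc act)
    then show "BS_action m n (g \<otimes>\<^bsub>BS m n\<^esub> h)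
        = BS_action m n g \<otimes>\<^bsub>BijGroup ?S\<^esub> BS_action m n h"
      using gh bij by (simp add: BijGroup_def)
  qed (simp add: BijGroup_def bij)
qed

definition BS_closure :: "int \<Rightarrow> int \<Rightarrow> (bs_gen gword set set \<Rightarrow> bs_gen gword set set) monoid" where
  "BS_closure m n = (BijGroup (BS_cosets m n))
    \<lparr>carrier := Abstract_Topology.closure_of (sym_topology (BS_cosets m n)) (BS_action m n ` carrier (BS m n))\<rparr>"

lemma group_BS_closure: "group (BS_closure m n)"
proof -
  interpret group_hom "BS m n" "BijGroup (BS_cosets m n)" "BS_action m n"
    by (intro group_hom.intro group_hom_axioms.intro group_BS group_BijGroup hom_BS_action)
  show ?thesis
    unfolding BS_closure_def
    by (intro subgroup.subgroup_is_group group_BijGroup subgroup_closure_sym_topology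
        img_is_subgroup)
qed

definition BS_closure_topology ::
    "int \<Rightarrow> int \<Rightarrow> (bs_gen gword set set \<Rightarrow> bs_gen gword set set) topology" where
  "BS_closure_topology m n =
    subtopology (sym_topology (BS_cosets m n)) (carrier (BS_closure m n))"

definition BS_A_closure :: "int \<Rightarrow> int \<Rightarrow> (bs_gen gword set set \<Rightarrow> bs_gen gword set set) set" where
  "BS_A_closure m n = Abstract_Topology.closure_of (BS_closure_topology m n) (BS_action m n ` BS_A m n)"


section \<open>p-adic integers and isomorphism of topological groups\<close>

text \<open>The additive group of p-adic integers is the inverse limit of the groups
  \<open>\<int>/p\<^sup>k\<close> with their discrete topologies.\<close>

definition padic_int_group :: "nat \<Rightarrow> (nat \<Rightarrow> int) monoid" where
  "padic_int_group p = (product_group UNIV (\<lambda>k. integer_mod_group (p ^ k)))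
    \<lparr>carrier := {x \<in> carrier (product_group UNIV (\<lambda>k. integer_mod_group (p ^ k))).
        \<forall>k. x (Suc k) mod int (p ^ k) = x k}\<rparr>"

definition padic_int_topology :: "nat \<Rightarrow> (nat \<Rightarrow> int) topology" where
  "padic_int_topology p =
    subtopology
      (product_topology (\<lambda>k. discrete_topology (carrier (integer_mod_group (p ^ k)))) UNIV)
      (carrier (padic_int_group p))"

definition top_group_iso ::
    "('a, 'c) monoid_scheme \<Rightarrow> 'a topology \<Rightarrow> ('b, 'd) monoid_scheme \<Rightarrow> 'b topology \<Rightarrow> bool" where
  "top_group_iso G X H Y \<longleftrightarrow> (\<exists>f. f \<in> iso G H \<and> homeomorphic_map X Y f)"

end

theory Submission
  imports
    Defs
    "HOL-Number_Theory.Cong"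
    "HOL-Algebra.Multiplicative_Group"
begin

text \<open>
  Write \<open>d = gcd m n\<close>, \<open>m = d * M\<close> and \<open>n = d * N\<close>, so that \<open>M\<close> and \<open>N\<close> are coprime and the primes of
  the theorem are the set \<open>P\<close> of prime divisors of \<open>M * N\<close>. The closure of the image of
  \<open>\<langle>a\<rangle>\<close> is a completion of \<open>\<int>\<close>: two exponents are close when the powers of \<open>a\<close> agree on a large
  finite set of cosets. Everything therefore depends on the stabilisers
  \<open>{k. a^k g \<langle>a\<rangle> = g \<langle>a\<rangle>}\<close> of the cosets, and two bounds determine them well enough.

  \<^item> They are large. The relation gives \<open>t a^(d M i) = a^(d N i) t\<close>, so moving a power
    \<open>a^k\<close> with \<open>d (M N)^(r + 1)\<close> dividing \<open>k\<close> past a letter yields a power of \<open>a\<close> whose exponent is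
    still divisible by \<open>d (M N)^r\<close>. Induction on a word for \<open>g\<close> shows that some
    \<open>d (M N)^r \<int>\<close> fixes \<open>g \<langle>a\<rangle>\<close> (lemma \<open>ex_power_fixing\<close>).
  \<^item> They are small. Under the affine representation \<open>a \<mapsto> (x \<mapsto> x + 1)\<close>,
    \<open>t \<mapsto> (x \<mapsto> (n / m) x)\<close> over the rationals, an exponent \<open>k\<close> that fixes the coset of \<open>t^L\<close> satisfies
    \<open>k = (N / M)^L j\<close> for an integer \<open>j\<close>, so \<open>N^L\<close> divides \<open>k\<close>; for \<open>t^(-L)\<close> the same holds with \<open>M\<close>
    (lemma \<open>fixes_t_coset\<close>). For \<open>L > 0\<close> the exact condition in the group is divisibility by \<open>d N^L\<close> and
    \<open>d M^L\<close>; the affine bound misses only the constant factor \<open>d\<close>, which does not affect the topology.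

  Hence the topology that the action induces on \<open>d \<int>\<close> is the \<open>P\<close>-adic one, and the closure \<open>V\<close> of the
  powers of \<open>a^d\<close> is the product of the \<open>\<int>\<^sub>p\<close> with \<open>p\<close> in \<open>P\<close>
  (theorem \<open>range_closure_iso_prod_padic_int\<close>). In particular \<open>V\<close> is compact. The finite union of the
  translates \<open>a^i V\<close> with \<open>0 \<le> i < d\<close> is then closed and contains all powers of \<open>a\<close>, so it is the
  whole closure. This makes the closure compact, \<open>V\<close> open in it, and the quotient cyclic,
  generated by the class of \<open>a\<close>, whose \<open>d\<close>-th power is trivial. Finally the closure of \<open>\<langle>a\<rangle>\<close>
  is open because it is the stabiliser of a point, the coset \<open>\<langle>a\<rangle>\<close> itself.
\<close>

section \<open>The p-adic integers as a compact group\<close>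

lemma padic_int_carrier_iff:
  assumes "0 < p"
  shows "x \<in> carrier (padic_int_group p) \<longleftrightarrow>
    (\<forall>k. 0 \<le> x k \<and> x k < int (p ^ k) \<and> x (Suc k) mod int (p ^ k) = x k)"
  using assms by (auto simp: padic_int_group_def carrier_integer_mod_group PiE_iff)

lemma padic_int_mult:
  "x \<otimes>\<^bsub>padic_int_group p\<^esub> y = (\<lambda>k. (x k + y k) mod int (p ^ k))"
  by (simp add: padic_int_group_def restrict_UNIV)

lemma padic_int_one: "\<one>\<^bsub>padic_int_group p\<^esub> = (\<lambda>k. 0)"
  by (simp add: padic_int_group_def restrict_UNIV)

lemma padic_int_mod_lower_level:
  assumes "0 < p" and x: "x \<in> carrier (padic_int_group p)" and "k \<le> l"
  shows "x l mod int (p ^ k) = x k"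
  using \<open>k \<le> l\<close>
proof (induction l rule: dec_induct)
  case base
  then show ?case using assms by (simp add: padic_int_carrier_iff)
next
  case (step l)
  have "x (Suc l) mod int (p ^ k) = (x (Suc l) mod int (p ^ l)) mod int (p ^ k)"
    using step by (simp add: mod_mod_cancel le_imp_power_dvd)
  also have "x (Suc l) mod int (p ^ l) = x l"
    using assms by (simp add: padic_int_carrier_iff)
  finally show ?case using step.IH by simp
qed

lemma padic_int_of_int:
  assumes "0 < p"
  shows "(\<lambda>k. j mod int (p ^ k)) \<in> carrier (padic_int_group p)"
  using assms by (simp add: padic_int_carrier_iff mod_mod_cancel)

text \<open>For sums and negatives of p-adic integers, which are computed level by level and then reduced.\<close>

lemma padic_int_levelwise_mod:
  assumes "0 < p" and "\<And>k. y (Suc k) mod int (p ^ k) = y k mod int (p ^ k)"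
  shows "(\<lambda>k. y k mod int (p ^ k)) \<in> carrier (padic_int_group p)"
  using assms by (simp add: padic_int_carrier_iff mod_mod_cancel)

lemma group_padic_int:
  assumes "0 < p"
  shows "group (padic_int_group p)"
proof (rule groupI)
  fix x y assume xy: "x \<in> carrier (padic_int_group p)" "y \<in> carrier (padic_int_group p)"
  have "(x (Suc k) + y (Suc k)) mod int (p ^ k) = (x k + y k) mod int (p ^ k)" for k
    using padic_int_mod_lower_level[OF assms xy(1), of k "Suc k"]
      padic_int_mod_lower_level[OF assms xy(2), of k "Suc k"]
    by (subst mod_add_eq[symmetric]) simp
  then show "x \<otimes>\<^bsub>padic_int_group p\<^esub> y \<in> carrier (padic_int_group p)"
    unfolding padic_int_mult by (intro padic_int_levelwise_mod assms)
next
  show "\<one>\<^bsub>padic_int_group p\<^esub> \<in> carrier (padic_int_group p)"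
    using assms by (simp add: padic_int_carrier_iff padic_int_one)
next
  fix x assume x: "x \<in> carrier (padic_int_group p)"
  show "\<one>\<^bsub>padic_int_group p\<^esub> \<otimes>\<^bsub>padic_int_group p\<^esub> x = x"
    using x assms by (simp add: padic_int_mult padic_int_one padic_int_carrier_iff)
  have "(- x (Suc k)) mod int (p ^ k) = (- x k) mod int (p ^ k)" for k
    using x assms padic_int_mod_lower_level[OF assms x, of k "Suc k"]
    by (subst mod_minus_eq[symmetric]) simp
  then have "(\<lambda>k. (- x k) mod int (p ^ k)) \<in> carrier (padic_int_group p)"
    by (intro padic_int_levelwise_mod assms)
  then show "\<exists>y\<in>carrier (padic_int_group p). y \<otimes>\<^bsub>padic_int_group p\<^esub> x = \<one>\<^bsub>padic_int_group p\<^esub>"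
    by (rule rev_bexI) (simp add: padic_int_mult padic_int_one mod_add_left_eq)
qed (simp add: padic_int_mult add.assoc mod_add_left_eq mod_add_right_eq)

lemma topspace_padic_int: "topspace (padic_int_topology p) = carrier (padic_int_group p)"
  by (auto simp: padic_int_topology_def padic_int_group_def)

lemma continuous_map_padic_int_level:
  "continuous_map (padic_int_topology p) (discrete_topology (carrier (integer_mod_group (p ^ k)))) (\<lambda>x. x k)"
  unfolding padic_int_topology_def
  by (intro continuous_map_from_subtopology continuous_map_product_projection) simp

lemma openin_padic_int_level:
  "openin (padic_int_topology p) {x \<in> carrier (padic_int_group p). x k = v}"
proof -
  have "openin (padic_int_topology p) {x \<in> topspace (padic_int_topology p).
      x k \<in> {v} \<inter> carrier (integer_mod_group (p ^ k))}"
    using continuous_map_padic_int_level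
    by (rule openin_continuous_map_preimage) simp
  moreover have "x k \<in> carrier (integer_mod_group (p ^ k))" if "x \<in> carrier (padic_int_group p)" for x
    using that by (auto simp: padic_int_group_def)
  then have "{x \<in> topspace (padic_int_topology p). x k \<in> {v} \<inter> carrier (integer_mod_group (p ^ k))}
      = {x \<in> carrier (padic_int_group p). x k = v}"
    by (auto simp: topspace_padic_int)
  ultimately show ?thesis by simp
qed

text \<open>The compatibility condition at each level is closed, so \<open>\<int>\<^sub>p\<close> is a closed subset of a product of
  finite discrete spaces.\<close>

lemma compact_space_padic_int:
  assumes "0 < p"
  shows "compact_space (padic_int_topology p)"
proof -
  let ?D = "\<lambda>k. discrete_topology (carrier (integer_mod_group (p ^ k)))"
  let ?T = "product_topology ?D UNIV"
  have proj: "continuous_map ?T (?D k) (\<lambda>x. x k)" for k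
    by (rule continuous_map_product_projection) simp
  have "closedin ?T {x \<in> topspace ?T. x (Suc k) mod int (p ^ k) = x k}" for k
  proof -
    have "continuous_map ?T (discrete_topology UNIV) (\<lambda>x. x (Suc k) mod int (p ^ k))"
      using continuous_map_compose[OF proj[of "Suc k"], of "discrete_topology UNIV" "\<lambda>i. i mod int (p ^ k)"]
      by (simp add: o_def)
    moreover have "continuous_map ?T (discrete_topology UNIV) (\<lambda>x. x k)"
      using continuous_map_compose[OF proj[of k], of "discrete_topology UNIV" "\<lambda>i. i"]
      by (simp add: o_def)
    ultimately show ?thesis
      by (intro closedin_continuous_maps_eq) simp_all
  qed
  then have "closedin ?T (\<Inter>k. {x \<in> topspace ?T. x (Suc k) mod int (p ^ k) = x k})"
    by (intro closedin_Inter) auto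
  moreover have "(\<Inter>k. {x \<in> topspace ?T. x (Suc k) mod int (p ^ k) = x k}) = carrier (padic_int_group p)"
    by (auto simp: padic_int_group_def)
  ultimately have "closedin ?T (carrier (padic_int_group p))"
    by simp
  moreover have "compact_space ?T"
    using assms by (simp add: compact_space_product_topology carrier_integer_mod_group compact_space_discrete_topology)
  ultimately show ?thesis
    unfolding padic_int_topology_def
    by (intro compact_space_subtopology closedin_compact_space)
qed

section \<open>Closures of permutation actions\<close>

lemma Hausdorff_sym_topology: "Hausdorff_space (sym_topology S)"
  unfolding sym_topology_def
  by (simp add: Hausdorff_space_subtopology Hausdorff_space_product_topology Hausdorff_space_discrete_topology)

lemma continuous_map_sym_topology_left_mult:
  assumes g: "g \<in> Bij S"
  shows "continuous_map (sym_topology S) (sym_topology S) (\<lambda>x. g \<otimes>\<^bsub>BijGroup S\<^esub> x)"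
  unfolding continuous_map_def topspace_sym_topology
proof (intro conjI allI impI)
  show "(\<lambda>x. g \<otimes>\<^bsub>BijGroup S\<^esub> x) \<in> Bij S \<rightarrow> Bij S"
    using g by (auto simp: BijGroup_def compose_Bij)
  fix U assume U: "openin (sym_topology S) U"
  show "openin (sym_topology S) {x \<in> Bij S. g \<otimes>\<^bsub>BijGroup S\<^esub> x \<in> U}"
    unfolding openin_sym_topology_iff
  proof (intro conjI ballI)
    fix x assume "x \<in> {x \<in> Bij S. g \<otimes>\<^bsub>BijGroup S\<^esub> x \<in> U}"
    then have x: "x \<in> Bij S" "compose S g x \<in> U"
      using g by (auto simp: BijGroup_def)
    then obtain F where F: "finite F" "F \<subseteq> S" "{y \<in> Bij S. \<forall>c\<in>F. y c = compose S g x c} \<subseteq> U"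
      using U unfolding openin_sym_topology_iff by blast
    have "compose S g y \<in> U" if "y \<in> Bij S" "\<forall>c\<in>F. y c = x c" for y
    proof (rule subsetD[OF F(3)])
      have "compose S g y c = compose S g x c" if "c \<in> F" for c
        using that F(2) \<open>\<forall>c\<in>F. y c = x c\<close> by (auto simp: compose_def)
      then show "compose S g y \<in> {y \<in> Bij S. \<forall>c\<in>F. y c = compose S g x c}"
        using compose_Bij[OF g that(1)] by blast
    qed
    then show "\<exists>F. finite F \<and> F \<subseteq> S \<and>
        {y \<in> Bij S. \<forall>c\<in>F. y c = x c} \<subseteq> {x \<in> Bij S. g \<otimes>\<^bsub>BijGroup S\<^esub> x \<in> U}"
      using F g by (intro exI[of _ F]) (auto simp: BijGroup_def)
  qed auto
qed

lemma BijGroup_apply: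
  "x \<in> Bij S \<Longrightarrow> y \<in> Bij S \<Longrightarrow> c \<in> S \<Longrightarrow> (x \<otimes>\<^bsub>BijGroup S\<^esub> y) c = x (y c)"
  by (simp add: BijGroup_def compose_def)

lemma Bij_eqI:
  assumes "x \<in> Bij S" "y \<in> Bij S" "\<And>c. c \<in> S \<Longrightarrow> x c = y c"
  shows "x = y"
  using assms Bij_imp_extensional by (metis extensionalityI)

text \<open>An action of \<open>\<int>\<close> on \<open>S\<close> by permutations, that is, the powers of one permutation. The exponent is
  kept as an argument because the topology of the closure is described on exponents.\<close>

locale int_action =
  fixes S :: "'a set" and \<beta> :: "int \<Rightarrow> 'a \<Rightarrow> 'a"
  assumes hom: "\<beta> \<in> hom integer_group (BijGroup S)"
begin

lemma Bij: "\<beta> j \<in> Bij S"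
  using hom by (auto simp: hom_def BijGroup_def)

lemma closed: "c \<in> S \<Longrightarrow> \<beta> j c \<in> S"
  using Bij_imp_funcset[OF Bij] by blast

lemma add: "c \<in> S \<Longrightarrow> \<beta> (i + j) c = \<beta> i (\<beta> j c)"
  using hom_mult[OF hom, of i j] by (simp add: BijGroup_apply Bij)

lemma zero: "c \<in> S \<Longrightarrow> \<beta> 0 c = c"
proof -
  assume c: "c \<in> S"
  have "\<beta> 0 = \<one>\<^bsub>BijGroup S\<^esub>"
    using hom_one[OF hom] by (simp add: group_BijGroup)
  then show ?thesis using c by (simp add: BijGroup_def)
qed

text \<open>Translates comparisons of two powers on a point into membership in the stabiliser of the point,
  which is where the arithmetic conditions apply.\<close>

lemma eq_iff_fixes_diff:
  assumes "c \<in> S" shows "\<beta> i c = \<beta> j c \<longleftrightarrow> \<beta> (i - j) c = c"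
proof
  assume "\<beta> i c = \<beta> j c"
  then have "\<beta> (- j + i) c = \<beta> (- j + j) c"
    using assms by (simp only: add)
  then show "\<beta> (i - j) c = c"
    using assms by (simp add: zero)
next
  assume "\<beta> (i - j) c = c"
  then have "\<beta> (j + (i - j)) c = \<beta> j c"
    using assms by (simp only: add)
  then show "\<beta> i c = \<beta> j c" by simp
qed

lemma subgroup_range: "subgroup (range \<beta>) (BijGroup S)"
proof -
  interpret group_hom integer_group "BijGroup S" \<beta>
    by (intro group_hom.intro group_hom_axioms.intro group_integer_group group_BijGroup hom)
  show ?thesis using img_is_subgroup by simp
qed

lemma range_subset: "range \<beta> \<subseteq> Bij S"
  using Bij by auto

definition range_closure where "range_closure = Abstract_Topology.closure_of (sym_topology S) (range \<beta>)"

lemma mem_range_closure_iff: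
  "x \<in> range_closure \<longleftrightarrow> x \<in> Bij S \<and> (\<forall>F. finite F \<and> F \<subseteq> S \<longrightarrow> (\<exists>k. \<forall>c\<in>F. \<beta> k c = x c))"
  unfolding range_closure_def in_closure_sym_topology_iff[OF range_subset] by simp

lemma subgroup_range_closure: "subgroup range_closure (BijGroup S)"
  unfolding range_closure_def by (intro subgroup_closure_sym_topology subgroup_range)

lemma range_subset_range_closure: "range \<beta> \<subseteq> range_closure"
  unfolding range_closure_def using range_subset
  by (simp add: closure_of_subset topspace_sym_topology)

end

section \<open>Actions of the integers that induce a product of p-adic topologies\<close>

text \<open>The two conditions on stabilisers say that the topology that the action induces on \<open>\<int>\<close> is the
  \<open>P\<close>-adic one: the exponents fixing a point contain all exponents divisible by a high power of every
  prime in \<open>P\<close>, and conversely those fixing a suitable finite set of points are divisible by any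
  prescribed such power.\<close>

locale padic_int_action = int_action +
  fixes P :: "nat set"
  assumes finite_P: "finite P" and prime_P: "p \<in> P \<Longrightarrow> prime p"
    and stabilizer_large: "c \<in> S \<Longrightarrow> \<exists>K. \<forall>j. (\<forall>p\<in>P. int (p ^ K) dvd j) \<longrightarrow> \<beta> j c = c"
    and stabilizers_small:
      "\<exists>F. finite F \<and> F \<subseteq> S \<and> (\<forall>j. (\<forall>c\<in>F. \<beta> j c = c) \<longrightarrow> (\<forall>p\<in>P. int (p ^ K) dvd j))"
begin

abbreviation Z where "Z \<equiv> product_group P padic_int_group"

text \<open>The integers that represent the family \<open>z\<close> of p-adic integers modulo the \<open>K\<close>-th powers of all primes
  in \<open>P\<close> at once. They give access to \<open>z\<close> through the action, which knows only integers.\<close>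

definition approx :: "(nat \<Rightarrow> nat \<Rightarrow> int) \<Rightarrow> nat \<Rightarrow> int \<Rightarrow> bool" where
  "approx z K j \<longleftrightarrow> (\<forall>p\<in>P. j mod int (p ^ K) = z p K)"

lemma P_pos: "p \<in> P \<Longrightarrow> 0 < p"
  using prime_P prime_gt_0_nat by blast

lemma group_Z: "group Z"
  by (intro product_group group_padic_int P_pos)

lemma Z_component: "z \<in> carrier Z \<Longrightarrow> p \<in> P \<Longrightarrow> z p \<in> carrier (padic_int_group p)"
  by auto

text \<open>The Chinese remainder theorem for the moduli \<open>p ^ K\<close> with \<open>p\<close> in \<open>P\<close>, applied to the residues as
  natural numbers.\<close>

lemma ex_approx:
  assumes z: "z \<in> carrier Z"
  shows "\<exists>j. approx z K j"
proof -
  have "\<forall>p\<in>P. \<forall>q\<in>P. p \<noteq> q \<longrightarrow> coprime (p ^ K) (q ^ K)"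
    using prime_P by (auto simp: primes_coprime)
  then obtain x where x: "\<And>p. p \<in> P \<Longrightarrow> [x = nat (z p K)] (mod p ^ K)"
    using chinese_remainder_nat[OF finite_P, of "\<lambda>p. p ^ K" "\<lambda>p. nat (z p K)"] by blast
  have "int x mod int (p ^ K) = z p K" if p: "p \<in> P" for p
  proof -
    have b: "0 \<le> z p K" "z p K < int (p ^ K)"
      using Z_component[OF z p] P_pos[OF p] by (auto simp: padic_int_carrier_iff)
    have "[int x = int (nat (z p K))] (mod int (p ^ K))"
      using x[OF p] by (simp only: cong_int_iff)
    then show ?thesis using b by (simp add: cong_def)
  qed
  then show ?thesis by (auto simp: approx_def)
qed

lemma approx_lower_level:
  assumes z: "z \<in> carrier Z" and "approx z L j" "K \<le> L"
  shows "approx z K j"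
  unfolding approx_def
proof
  fix p assume p: "p \<in> P"
  have "j mod int (p ^ K) = (j mod int (p ^ L)) mod int (p ^ K)"
    using \<open>K \<le> L\<close> by (simp add: mod_mod_cancel le_imp_power_dvd)
  also have "\<dots> = z p K"
    using assms p padic_int_mod_lower_level[OF P_pos[OF p] Z_component[OF z p]]
    by (simp add: approx_def)
  finally show "j mod int (p ^ K) = z p K" .
qed

lemma approx_diff:
  assumes "approx z K i" "approx z K j" "p \<in> P"
  shows "int (p ^ K) dvd i - j"
  using assms unfolding approx_def mod_eq_dvd_iff[symmetric] by metis

lemma approx_mult:
  assumes "approx z K i" "approx w K j"
  shows "approx (z \<otimes>\<^bsub>Z\<^esub> w) K (i + j)"
  unfolding approx_def
proof
  fix p assume "p \<in> P"
  then have "(z \<otimes>\<^bsub>Z\<^esub> w) p K = (i mod int (p ^ K) + j mod int (p ^ K)) mod int (p ^ K)"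
    using assms by (simp add: approx_def padic_int_mult)
  then show "(i + j) mod int (p ^ K) = (z \<otimes>\<^bsub>Z\<^esub> w) p K"
    by (simp only: mod_add_eq)
qed

lemma approx_one: "approx \<one>\<^bsub>Z\<^esub> K 0"
  by (simp add: approx_def padic_int_one)

definition of_int_Z :: "int \<Rightarrow> nat \<Rightarrow> nat \<Rightarrow> int" where
  "of_int_Z j = (\<lambda>p\<in>P. \<lambda>k. j mod int (p ^ k))"

lemma of_int_Z_carrier: "of_int_Z j \<in> carrier Z"
  unfolding of_int_Z_def carrier_product_group restrict_PiE_iff
  using padic_int_of_int P_pos by blast

lemma approx_of_int_Z: "approx (of_int_Z j) K j"
  by (simp add: approx_def of_int_Z_def)

text \<open>A level from which on divisibility of an exponent forces it to fix \<open>c\<close>.\<close>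

definition lev :: "'a \<Rightarrow> nat" where
  "lev c = (SOME K. \<forall>j. (\<forall>p\<in>P. int (p ^ K) dvd j) \<longrightarrow> \<beta> j c = c)"

text \<open>The permutation that a family of p-adic integers acts by: on a point \<open>c\<close> it agrees with every
  integer that approximates the family well enough for \<open>c\<close>. This is the limit of the powers with
  exponents converging to \<open>z\<close>, but written down directly, without a choice of a sequence.\<close>

definition \<Phi> :: "(nat \<Rightarrow> nat \<Rightarrow> int) \<Rightarrow> 'a \<Rightarrow> 'a" where
  "\<Phi> z = (\<lambda>c\<in>S. \<beta> (SOME j. approx z (lev c) j) c)"

lemma fixes_if_level_dvd:
  assumes "c \<in> S" "\<And>p. p \<in> P \<Longrightarrow> int (p ^ lev c) dvd j"
  shows "\<beta> j c = c"
  using someI_ex[OF stabilizer_large[OF assms(1)]] assms(2) unfolding lev_def by blast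

text \<open>Two approximations at a level at least \<open>lev c\<close> differ by an exponent that fixes \<open>c\<close>, so the
  representative chosen in the definition can be replaced by any other one. All further properties of
  \<open>\<Phi>\<close> follow from this by choosing one level that is good for finitely many points.\<close>

lemma \<Phi>_eq:
  assumes z: "z \<in> carrier Z" and c: "c \<in> S" and K: "lev c \<le> K" and j: "approx z K j"
  shows "\<Phi> z c = \<beta> j c"
proof -
  let ?i = "SOME j. approx z (lev c) j"
  have "approx z (lev c) ?i"
    using ex_approx[OF z] by (rule someI_ex)
  moreover have "approx z (lev c) j"
    using approx_lower_level[OF z j K] .
  ultimately have "\<beta> (?i - j) c = c"
    using c approx_diff by (intro fixes_if_level_dvd) auto
  then show ?thesis
    using c by (simp add: \<Phi>_def eq_iff_fixes_diff)
qed

lemma \<Phi>_closed: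
  assumes "c \<in> S" shows "\<Phi> z c \<in> S"
  using assms by (simp add: \<Phi>_def closed)

lemma \<Phi>_mult:
  assumes z: "z \<in> carrier Z" and w: "w \<in> carrier Z" and c: "c \<in> S"
  shows "\<Phi> (z \<otimes>\<^bsub>Z\<^esub> w) c = \<Phi> z (\<Phi> w c)"
proof -
  define K where "K = max (lev c) (lev (\<Phi> w c))"
  obtain i j where ij: "approx z K i" "approx w K j"
    using ex_approx z w by blast
  have zw: "z \<otimes>\<^bsub>Z\<^esub> w \<in> carrier Z"
    using group.is_monoid[OF group_Z] z w by (rule monoid.m_closed)
  have wc: "\<Phi> w c = \<beta> j c"
    by (rule \<Phi>_eq[OF w c _ ij(2)]) (simp add: K_def)
  have "\<Phi> (z \<otimes>\<^bsub>Z\<^esub> w) c = \<beta> (i + j) c"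
    by (rule \<Phi>_eq[OF zw c _ approx_mult[OF ij]]) (simp add: K_def)
  also have "\<dots> = \<beta> i (\<Phi> w c)"
    using c wc by (simp add: add)
  also have "\<dots> = \<Phi> z (\<Phi> w c)"
    by (rule \<Phi>_eq[OF z \<Phi>_closed[OF c] _ ij(1), symmetric]) (simp add: K_def)
  finally show ?thesis .
qed

lemma \<Phi>_of_int_Z: "\<Phi> (of_int_Z j) = \<beta> j"
proof (rule extensionalityI[of _ S])
  show "\<Phi> (of_int_Z j) c = \<beta> j c" if "c \<in> S" for c
    using \<Phi>_eq[OF of_int_Z_carrier that order_refl approx_of_int_Z] .
  show "\<Phi> (of_int_Z j) \<in> extensional S"
    by (simp add: \<Phi>_def)
  show "\<beta> j \<in> extensional S"
    using Bij by (rule Bij_imp_extensional)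
qed

lemma \<Phi>_one:
  assumes "c \<in> S"
  shows "\<Phi> \<one>\<^bsub>Z\<^esub> c = c"
  using \<Phi>_eq[OF monoid.one_closed[OF group.is_monoid[OF group_Z]] assms order_refl approx_one]
  unfolding zero[OF assms] .

text \<open>Bijectivity is not automatic for pointwise limits of permutations. It holds here because the
  group of p-adic families also supplies the inverse.\<close>

lemma \<Phi>_Bij:
  assumes z: "z \<in> carrier Z"
  shows "\<Phi> z \<in> Bij S"
proof -
  let ?w = "inv\<^bsub>Z\<^esub> z"
  have w: "?w \<in> carrier Z" using group.inv_closed[OF group_Z z] .
  have "bij_betw (\<Phi> z) S S"
  proof (rule bij_betw_byWitness[where f' = "\<Phi> ?w"])
    show "\<forall>c\<in>S. \<Phi> ?w (\<Phi> z c) = c"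
      using \<Phi>_mult[OF w z] \<Phi>_one unfolding group.l_inv[OF group_Z z] by metis
    show "\<forall>c\<in>S. \<Phi> z (\<Phi> ?w c) = c"
      using \<Phi>_mult[OF z w] \<Phi>_one unfolding group.r_inv[OF group_Z z] by metis
  qed (use \<Phi>_closed in blast)+
  then show ?thesis by (simp add: Bij_def \<Phi>_def)
qed

lemma \<Phi>_hom: "\<Phi> \<in> hom Z (BijGroup S)"
proof (rule homI)
  show "\<Phi> z \<in> carrier (BijGroup S)" if "z \<in> carrier Z" for z
    using \<Phi>_Bij[OF that] by (simp add: BijGroup_def)
  show "\<Phi> (z \<otimes>\<^bsub>Z\<^esub> w) = \<Phi> z \<otimes>\<^bsub>BijGroup S\<^esub> \<Phi> w" if "z \<in> carrier Z" "w \<in> carrier Z" for z w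
  proof (rule Bij_eqI)
    show "\<Phi> (z \<otimes>\<^bsub>Z\<^esub> w) \<in> Bij S"
      using monoid.m_closed[OF group.is_monoid[OF group_Z] that] by (rule \<Phi>_Bij)
    show "\<Phi> z \<otimes>\<^bsub>BijGroup S\<^esub> \<Phi> w \<in> Bij S"
      using that by (simp add: BijGroup_def \<Phi>_Bij compose_Bij del: carrier_product_group)
    show "\<Phi> (z \<otimes>\<^bsub>Z\<^esub> w) c = (\<Phi> z \<otimes>\<^bsub>BijGroup S\<^esub> \<Phi> w) c" if "c \<in> S" for c
      using \<Phi>_mult[OF \<open>z \<in> carrier Z\<close> \<open>w \<in> carrier Z\<close> that] BijGroup_apply[OF \<Phi>_Bij \<Phi>_Bij that]
        \<open>z \<in> carrier Z\<close> \<open>w \<in> carrier Z\<close> by metis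
  qed
qed

text \<open>The extra bound \<open>L\<close> allows the caller to fix a further level in the same step.\<close>

lemma ex_common_level:
  assumes "finite F"
  obtains K where "\<And>c. c \<in> F \<Longrightarrow> lev c \<le> K" "L \<le> K"
proof (rule that)
  show "lev c \<le> L + (\<Sum>c\<in>F. lev c)" if "c \<in> F" for c
    using member_le_sum[OF that, of lev] assms by simp
qed simp

text \<open>If \<open>z\<close> and \<open>w\<close> act equally, then so do good integer approximations on the finite set that
  detects divisibility by the \<open>K\<close>-th powers, whence \<open>z\<close> and \<open>w\<close> agree at level \<open>K\<close>.\<close>

lemma \<Phi>_inj: "inj_on \<Phi> (carrier Z)"
proof (rule inj_onI)
  fix z w assume z: "z \<in> carrier Z" and w: "w \<in> carrier Z" and eq: "\<Phi> z = \<Phi> w"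
  have "z p K = w p K" if p: "p \<in> P" for p K
  proof -
    obtain F where F: "finite F" "F \<subseteq> S"
        "\<And>j p. (\<forall>c\<in>F. \<beta> j c = c) \<Longrightarrow> p \<in> P \<Longrightarrow> int (p ^ K) dvd j"
      using stabilizers_small[of K] by blast
    obtain L where L: "\<And>c. c \<in> F \<Longrightarrow> lev c \<le> L" "K \<le> L"
      using ex_common_level[OF F(1)] by blast
    obtain i j where ij: "approx z L i" "approx w L j"
      using ex_approx z w by blast
    have "\<beta> (i - j) c = c" if "c \<in> F" for c
      using \<Phi>_eq[OF z _ L(1)[OF that] ij(1)] \<Phi>_eq[OF w _ L(1)[OF that] ij(2)] eq that F(2)
      by (auto simp flip: eq_iff_fixes_diff)
    then have "int (p ^ K) dvd i - j"
      using F(3) p by blast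
    moreover have "approx z K i" "approx w K j"
      using approx_lower_level z w ij L by blast+
    ultimately show ?thesis
      using p unfolding approx_def mod_eq_dvd_iff[symmetric] by metis
  qed
  then show "z = w"
    using z w by (intro PiE_ext[of z P _ w]) auto
qed

abbreviation Z_top where "Z_top \<equiv> product_topology padic_int_topology P"

lemma topspace_Z: "topspace Z_top = carrier Z"
  by (simp only: topspace_product_topology carrier_product_group topspace_padic_int o_def)

text \<open>Each evaluation \<open>z \<mapsto> \<Phi> z c\<close> depends only on the components of \<open>z\<close> at level \<open>lev c\<close>, so it is locally
  constant. Finiteness of \<open>P\<close> makes the set of families with prescribed components open.\<close>

lemma \<Phi>_continuous: "continuous_map Z_top (sym_topology S) \<Phi>"
proof -
  have "continuous_map Z_top (discrete_topology S) (\<lambda>z. \<Phi> z c)" if c: "c \<in> S" for c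
    unfolding continuous_map_def
  proof (intro conjI allI impI)
    show "(\<lambda>z. \<Phi> z c) \<in> topspace Z_top \<rightarrow> topspace (discrete_topology S)"
      using c \<Phi>_closed by simp
    fix U assume "openin (discrete_topology S) U"
    show "openin Z_top {z \<in> topspace Z_top. \<Phi> z c \<in> U}"
    proof (subst openin_subopen, intro ballI)
      fix z assume "z \<in> {z \<in> topspace Z_top. \<Phi> z c \<in> U}"
      then have z: "z \<in> carrier Z" "\<Phi> z c \<in> U"
        unfolding mem_Collect_eq topspace_Z by blast+
      let ?N = "\<Pi>\<^sub>E p\<in>P. {x \<in> carrier (padic_int_group p). x (lev c) = z p (lev c)}"
      have "openin Z_top ?N"
        unfolding openin_PiE[OF finite_P] using openin_padic_int_level by blast
      moreover have "z \<in> ?N"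
        using z(1) unfolding carrier_product_group PiE_iff by blast
      moreover have "?N \<subseteq> {z \<in> topspace Z_top. \<Phi> z c \<in> U}"
      proof
        fix w assume w': "w \<in> ?N"
        then have w: "w \<in> carrier Z"
          unfolding carrier_product_group PiE_iff by blast
        obtain j where j: "approx z (lev c) j"
          using ex_approx[OF z(1)] by blast
        then have "approx w (lev c) j"
          using w' unfolding approx_def PiE_iff by simp
        then have "\<Phi> w c = \<Phi> z c"
          using \<Phi>_eq[OF w c order_refl] \<Phi>_eq[OF z(1) c order_refl j] by simp
        then show "w \<in> {z \<in> topspace Z_top. \<Phi> z c \<in> U}"
          using w z(2) unfolding mem_Collect_eq topspace_Z by simp
      qed
      ultimately show "\<exists>T. openin Z_top T \<and> z \<in> T \<and> T \<subseteq> {z \<in> topspace Z_top. \<Phi> z c \<in> U}"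
        by blast
    qed
  qed
  then have "continuous_map Z_top (product_topology (\<lambda>_. discrete_topology S) S) \<Phi>"
    by (auto simp: continuous_map_componentwise \<Phi>_def)
  then show ?thesis
    unfolding sym_topology_def
    by (rule continuous_map_into_subtopology) (unfold topspace_Z, use \<Phi>_Bij in blast)
qed

lemma compact_space_Z: "compact_space Z_top"
  unfolding compact_space_product_topology using compact_space_padic_int P_pos by blast

text \<open>One inclusion is approximation by integers. For the other, the image is compact, hence closed in
  a Hausdorff space, and it contains the action of every integer.\<close>

lemma \<Phi>_image: "\<Phi> ` carrier Z = range_closure"
proof (rule antisym)
  show "\<Phi> ` carrier Z \<subseteq> range_closure"
  proof
    fix x assume "x \<in> \<Phi> ` carrier Z"
    then obtain z where z: "z \<in> carrier Z" "x = \<Phi> z" by blast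
    have "\<exists>j. \<forall>c\<in>F. \<beta> j c = x c" if F: "finite F" "F \<subseteq> S" for F
    proof -
      obtain K where K: "\<And>c. c \<in> F \<Longrightarrow> lev c \<le> K"
        using ex_common_level[OF F(1)] by blast
      obtain j where j: "approx z K j"
        using ex_approx[OF z(1)] by blast
      have "\<forall>c\<in>F. \<beta> j c = x c"
        using \<Phi>_eq[OF z(1) _ K j] F(2) z(2) by auto
      then show ?thesis by blast
    qed
    then show "x \<in> range_closure"
      unfolding mem_range_closure_iff using \<Phi>_Bij[OF z(1)] z(2) by simp
  qed
  have "compactin (sym_topology S) (\<Phi> ` carrier Z)"
    using image_compactin[OF _ \<Phi>_continuous, of "topspace Z_top"] compact_space_Z topspace_Z
    by (metis compact_space_def)
  then have "closedin (sym_topology S) (\<Phi> ` carrier Z)"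
    by (rule compactin_imp_closedin[OF Hausdorff_sym_topology])
  moreover have "range \<beta> \<subseteq> \<Phi> ` carrier Z"
    using \<Phi>_of_int_Z of_int_Z_carrier by (metis image_eqI image_subsetI)
  ultimately show "range_closure \<subseteq> \<Phi> ` carrier Z"
    unfolding range_closure_def by (intro closure_of_minimal)
qed

text \<open>A continuous bijection from a compact space to a Hausdorff space is a homeomorphism, so the inverse
  of \<open>\<Phi>\<close> is the isomorphism of topological groups.\<close>

theorem range_closure_iso_prod_padic_int:
  shows "compactin (sym_topology S) range_closure"
    and "top_group_iso ((BijGroup S)\<lparr>carrier := range_closure\<rparr>)
      (subtopology (sym_topology S) range_closure) Z Z_top"
proof -
  let ?V = range_closure
  have V: "\<Phi> ` topspace Z_top = ?V"
    unfolding topspace_Z by (rule \<Phi>_image)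
  show "compactin (sym_topology S) ?V"
    using image_compactin[OF _ \<Phi>_continuous, of "topspace Z_top"] compact_space_Z
    unfolding V compact_space_def by blast
  let ?g = "inv_into (carrier Z) \<Phi>"
  have "\<Phi> \<in> iso Z ((BijGroup S)\<lparr>carrier := ?V\<rparr>)"
    using \<Phi>_hom \<Phi>_inj V unfolding topspace_Z iso_def hom_def bij_betw_def by auto
  then have "?g \<in> iso ((BijGroup S)\<lparr>carrier := ?V\<rparr>) Z"
    by (rule group.iso_set_sym[OF group_Z])
  moreover have "homeomorphic_map (subtopology (sym_topology S) ?V) Z_top ?g"
  proof -
    have cont: "continuous_map Z_top (subtopology (sym_topology S) ?V) \<Phi>"
      using \<Phi>_continuous V by (auto simp: continuous_map_in_subtopology)
    have ts: "topspace (subtopology (sym_topology S) ?V) = ?V"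
      using V continuous_map_image_subset_topspace[OF \<Phi>_continuous] by auto
    have "homeomorphic_map Z_top (subtopology (sym_topology S) ?V) \<Phi>"
    proof (rule bijective_closed_imp_homeomorphic_map[OF cont])
      show "closed_map Z_top (subtopology (sym_topology S) ?V) \<Phi>"
        by (rule continuous_imp_closed_map_gen[OF compact_space_Z _ cont])
           (intro Hausdorff_imp_kc_space Hausdorff_space_subtopology Hausdorff_sym_topology)
      show "\<Phi> ` topspace Z_top = topspace (subtopology (sym_topology S) ?V)"
        unfolding ts by (rule V)
      show "inj_on \<Phi> (topspace Z_top)"
        unfolding topspace_Z by (rule \<Phi>_inj)
    qed
    then obtain h where h: "homeomorphic_maps Z_top (subtopology (sym_topology S) ?V) \<Phi> h"
      unfolding homeomorphic_map_maps by blast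
    have "h x = ?g x" if "x \<in> topspace (subtopology (sym_topology S) ?V)" for x
    proof -
      have "h x \<in> carrier Z" "\<Phi> (h x) = x"
        using h that unfolding homeomorphic_maps_def continuous_map_def topspace_Z by blast+
      then show ?thesis
        using inv_into_f_f[OF \<Phi>_inj] by metis
    qed
    moreover have "homeomorphic_map (subtopology (sym_topology S) ?V) Z_top h"
      using h homeomorphic_maps_sym homeomorphic_maps_map by blast
    ultimately show ?thesis
      using homeomorphic_map_eq by blast
  qed
  ultimately show "top_group_iso ((BijGroup S)\<lparr>carrier := ?V\<rparr>) (subtopology (sym_topology S) ?V) Z Z_top"
    unfolding top_group_iso_def by blast
qed

end

section \<open>The closure of a cyclic group and the closure of a subgroup of multiples\<close>

context int_action
begin

text \<open>On a single point, \<open>x\<close> and \<open>y\<close> can be replaced by powers of the same permutation; the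
  approximations must be good on the point and on its image under the other map.\<close>

lemma range_closure_commute:
  assumes x: "x \<in> range_closure" and y: "y \<in> range_closure"
  shows "x \<otimes>\<^bsub>BijGroup S\<^esub> y = y \<otimes>\<^bsub>BijGroup S\<^esub> x"
proof (rule Bij_eqI)
  have B: "x \<in> Bij S" "y \<in> Bij S"
    using x y mem_range_closure_iff by blast+
  show "x \<otimes>\<^bsub>BijGroup S\<^esub> y \<in> Bij S" "y \<otimes>\<^bsub>BijGroup S\<^esub> x \<in> Bij S"
    using B by (simp_all add: BijGroup_def compose_Bij)
  fix c assume c: "c \<in> S"
  have xc: "x c \<in> S" and yc: "y c \<in> S"
    using B c Bij_imp_funcset by blast+
  obtain i where i: "\<beta> i c = x c" "\<beta> i (y c) = x (y c)"
    using x[unfolded mem_range_closure_iff, THEN conjunct2, rule_format, of "{c, y c}"] c yc by auto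
  obtain j where j: "\<beta> j c = y c" "\<beta> j (x c) = y (x c)"
    using y[unfolded mem_range_closure_iff, THEN conjunct2, rule_format, of "{c, x c}"] c xc by auto
  have "x (y c) = \<beta> (i + j) c"
    using c i j by (simp add: add)
  also have "\<dots> = y (x c)"
    using add[OF c, of j i] i j by (simp add: add.commute)
  finally show "(x \<otimes>\<^bsub>BijGroup S\<^esub> y) c = (y \<otimes>\<^bsub>BijGroup S\<^esub> x) c"
    using B c by (simp add: BijGroup_apply)
qed

lemma comm_group_range_closure: "comm_group ((BijGroup S)\<lparr>carrier := range_closure\<rparr>)"
  by (rule group.group_comm_groupI[OF subgroup.subgroup_is_group[OF subgroup_range_closure group_BijGroup]])
     (simp add: range_closure_commute)

lemma hom_range_closure: "\<beta> \<in> hom integer_group ((BijGroup S)\<lparr>carrier := range_closure\<rparr>)"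
  using hom range_subset_range_closure by (auto simp: hom_def)

lemma int_action_multiples: "int_action S (\<lambda>k. \<beta> (d * k))"
proof
  show "(\<lambda>k. \<beta> (d * k)) \<in> hom integer_group (BijGroup S)"
    using hom by (auto simp: hom_def distrib_left)
qed

text \<open>Compactness of the closure \<open>V\<close> of the multiples of \<open>d\<close> turns the decomposition of \<open>\<int>\<close> into residue
  classes modulo \<open>d\<close> into a decomposition of the closure into translates of \<open>V\<close>.\<close>

context
  fixes d :: int and V
  assumes d: "0 < d"
    and V_def: "V = int_action.range_closure S (\<lambda>k. \<beta> (d * k))"
    and V_compact: "compactin (sym_topology S) V"
begin

interpretation multiples: int_action S "\<lambda>k. \<beta> (d * k)"
  by (rule int_action_multiples)

abbreviation closure_group where "closure_group \<equiv> (BijGroup S)\<lparr>carrier := range_closure\<rparr>"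

abbreviation translate where "translate i \<equiv> (\<lambda>x. \<beta> i \<otimes>\<^bsub>BijGroup S\<^esub> x) ` V"

lemma V_subset: "V \<subseteq> range_closure"
  unfolding V_def multiples.range_closure_def range_closure_def by (intro closure_of_mono) auto

lemma subgroup_V: "subgroup V (BijGroup S)"
  unfolding V_def by (rule multiples.subgroup_range_closure)

lemma V_normal: "V \<lhd> closure_group"
proof -
  interpret comm_group closure_group by (rule comm_group_range_closure)
  show ?thesis
    using group.subgroup_incl[OF group_BijGroup subgroup_V subgroup_range_closure V_subset]
    by (rule subgroup_imp_normal)
qed

lemma compactin_translate: "compactin (sym_topology S) (translate i)"
  using image_compactin[OF V_compact continuous_map_sym_topology_left_mult[OF Bij]] .

text \<open>The union is finite, so it is closed, and by division with remainder it contains every power.\<close>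

lemma range_closure_eq_Union_translates: "range_closure = (\<Union>i\<in>{0..<d}. translate i)"
proof (rule antisym)
  have "closedin (sym_topology S) (\<Union>i\<in>{0..<d}. translate i)"
    by (intro closedin_Union) (auto intro: compactin_imp_closedin[OF Hausdorff_sym_topology] compactin_translate)
  moreover have "range \<beta> \<subseteq> (\<Union>i\<in>{0..<d}. translate i)"
  proof
    fix x assume "x \<in> range \<beta>"
    then obtain k where k: "x = \<beta> k" by blast
    have "x = \<beta> (k mod d) \<otimes>\<^bsub>BijGroup S\<^esub> \<beta> (d * (k div d))"
      using hom_mult[OF hom, of "k mod d" "d * (k div d)"] by (simp add: k add.commute)
    moreover have "\<beta> (d * (k div d)) \<in> V"
      using multiples.range_subset_range_closure unfolding V_def by blast
    moreover have "k mod d \<in> {0..<d}" using d by simp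
    ultimately show "x \<in> (\<Union>i\<in>{0..<d}. translate i)" by blast
  qed
  ultimately show "range_closure \<subseteq> (\<Union>i\<in>{0..<d}. translate i)"
    unfolding range_closure_def by (intro closure_of_minimal)
  show "(\<Union>i\<in>{0..<d}. translate i) \<subseteq> range_closure"
    using V_subset range_subset_range_closure subgroup.m_closed[OF subgroup_range_closure] by blast
qed

lemma compactin_range_closure: "compactin (sym_topology S) range_closure"
  unfolding range_closure_eq_Union_translates
  by (intro compactin_Union) (auto intro: compactin_translate)

text \<open>The complement of \<open>V\<close> in the closure is the union of those finitely many translates that are
  different from \<open>V\<close>, and each of them is closed.\<close>

lemma V_open: "openin (subtopology (sym_topology S) range_closure) V"
proof -
  define I where "I = {i\<in>{0..<d}. \<beta> i \<notin> V}"
  have "finite I"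
    by (rule finite_subset[of _ "{0..<d}"]) (auto simp: I_def)
  then have "closedin (sym_topology S) (\<Union>i\<in>I. translate i)"
    by (intro closedin_Union)
       (auto intro: compactin_imp_closedin[OF Hausdorff_sym_topology] compactin_translate)
  then have "openin (sym_topology S) (Bij S - (\<Union>i\<in>I. translate i))"
    by (simp add: closedin_def topspace_sym_topology)
  moreover have "V = (Bij S - (\<Union>i\<in>I. translate i)) \<inter> range_closure"
  proof (rule antisym)
    have "\<beta> i \<in> V" if v: "v \<in> V" and m: "\<beta> i \<otimes>\<^bsub>BijGroup S\<^esub> v \<in> V" for i v
    proof -
      interpret group "BijGroup S" by (rule group_BijGroup)
      have c: "\<beta> i \<in> carrier (BijGroup S)" "v \<in> carrier (BijGroup S)"
        using Bij v subgroup.subset[OF subgroup_V] by (auto simp: BijGroup_def)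
      have "(\<beta> i \<otimes>\<^bsub>BijGroup S\<^esub> v) \<otimes>\<^bsub>BijGroup S\<^esub> inv\<^bsub>BijGroup S\<^esub> v \<in> V"
        using v m subgroup_V by (meson subgroup.m_closed subgroup.m_inv_closed)
      then show ?thesis using c by (simp add: m_assoc)
    qed
    then have "V \<inter> (\<Union>i\<in>I. translate i) = {}"
      unfolding I_def by blast
    moreover have "V \<subseteq> Bij S"
      using subgroup.subset[OF subgroup_V] by (simp add: BijGroup_def)
    ultimately show "V \<subseteq> (Bij S - (\<Union>i\<in>I. translate i)) \<inter> range_closure"
      using V_subset by blast
    show "(Bij S - (\<Union>i\<in>I. translate i)) \<inter> range_closure \<subseteq> V"
    proof
      fix x assume x: "x \<in> (Bij S - (\<Union>i\<in>I. translate i)) \<inter> range_closure"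
      then obtain i v where iv: "i \<in> {0..<d}" "v \<in> V" "x = \<beta> i \<otimes>\<^bsub>BijGroup S\<^esub> v"
        unfolding range_closure_eq_Union_translates by blast
      then have "\<beta> i \<in> V"
        using x unfolding I_def by blast
      then show "x \<in> V"
        using iv subgroup.m_closed[OF subgroup_V] by blast
    qed
  qed
  ultimately show ?thesis
    unfolding openin_subtopology by blast
qed

text \<open>The class \<open>g\<close> of the generator generates the quotient, and \<open>g\<close> to the power \<open>d\<close> is trivial because
  \<open>\<beta> d\<close> lies in \<open>V\<close>; so the order of the quotient, which is the order of \<open>g\<close>, divides \<open>d\<close>.\<close>

lemma quotient_cyclic:
  shows "finite (carrier (closure_group Mod V))" "cyclic_group (closure_group Mod V)" "int (order (closure_group Mod V)) dvd d"
proof -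
  interpret N: normal V closure_group by (rule V_normal)
  interpret Q: group "closure_group Mod V" by (rule N.factorgroup_is_group)
  let ?h = "\<lambda>k. V #>\<^bsub>closure_group\<^esub> \<beta> k"
  have h: "?h \<in> hom integer_group (closure_group Mod V)"
    using hom_compose[OF hom_range_closure N.r_coset_hom_Mod] by (simp add: o_def)
  interpret h: group_hom integer_group "closure_group Mod V" ?h
    by (intro group_hom.intro group_hom_axioms.intro group_integer_group Q.is_group h)
  define g where "g = ?h 1"
  have g: "g \<in> carrier (closure_group Mod V)"
    unfolding g_def by (rule h.hom_closed) simp
  have pow: "?h k = g [^]\<^bsub>closure_group Mod V\<^esub> k" for k :: int
    using h.hom_int_pow[of 1 k] by (simp add: g_def)
  have carrier: "carrier (closure_group Mod V) = ?h ` {0..<d}"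
  proof (rule antisym)
    show "carrier (closure_group Mod V) \<subseteq> ?h ` {0..<d}"
    proof
      fix X assume "X \<in> carrier (closure_group Mod V)"
      then obtain x where x: "x \<in> range_closure" "X = V #>\<^bsub>closure_group\<^esub> x"
        by (auto simp: FactGroup_def RCOSETS_def)
      then obtain i v where iv: "i \<in> {0..<d}" "v \<in> V" "x = \<beta> i \<otimes>\<^bsub>BijGroup S\<^esub> v"
        unfolding range_closure_eq_Union_translates by blast
      have bi: "\<beta> i \<in> range_closure" using range_subset_range_closure by blast
      then have "x = v \<otimes>\<^bsub>closure_group\<^esub> \<beta> i"
        using iv V_subset range_closure_commute by auto
      then have "x \<in> V #>\<^bsub>closure_group\<^esub> \<beta> i"
        using iv(2) by (auto simp: r_coset_def)
      then have "V #>\<^bsub>closure_group\<^esub> \<beta> i = V #>\<^bsub>closure_group\<^esub> x"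
        using bi by (intro N.repr_independence N.subgroup_axioms) simp_all
      then show "X \<in> ?h ` {0..<d}"
        using x iv by blast
    qed
    show "?h ` {0..<d} \<subseteq> carrier (closure_group Mod V)"
      using h.hom_closed by auto
  qed
  then show fin: "finite (carrier (closure_group Mod V))" by simp
  have gen: "carrier (closure_group Mod V) = range (\<lambda>k::int. g [^]\<^bsub>closure_group Mod V\<^esub> k)"
  proof (rule antisym)
    show "carrier (closure_group Mod V) \<subseteq> range (\<lambda>k::int. g [^]\<^bsub>closure_group Mod V\<^esub> k)"
      unfolding carrier pow by blast
    show "range (\<lambda>k::int. g [^]\<^bsub>closure_group Mod V\<^esub> k) \<subseteq> carrier (closure_group Mod V)"
      using g by auto
  qed
  then show "cyclic_group (closure_group Mod V)"
    using g Q.cyclic_group by blast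
  have "generate (closure_group Mod V) {g} = carrier (closure_group Mod V)"
    unfolding gen Q.generate_pow[OF g] by blast
  then have "order (closure_group Mod V) = Q.ord g"
    by (simp add: order_def Q.generate_pow_card[OF g])
  moreover have "g [^]\<^bsub>closure_group Mod V\<^esub> nat d = \<one>\<^bsub>closure_group Mod V\<^esub>"
  proof -
    have "\<beta> d \<in> V"
      using multiples.range_subset_range_closure unfolding V_def by (metis mult.right_neutral rangeI subsetD)
    then have "?h d = V"
      using N.rcos_const by simp
    then show ?thesis
      using pow[of d] d by (simp add: FactGroup_def flip: int_pow_int)
  qed
  ultimately have "order (closure_group Mod V) dvd nat d"
    using Q.pow_eq_id[OF g] by simp
  then show "int (order (closure_group Mod V)) dvd d"
    using d by (metis int_dvd_int_iff int_nat_eq less_imp_le)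
qed

end
end

section \<open>Divisibility by prime powers\<close>

lemma multiplicity_le_abs:
  fixes p q :: int
  assumes "prime p" "q \<noteq> 0"
  shows "multiplicity p q \<le> nat \<bar>q\<bar>"
proof -
  have "int (multiplicity p q) < 2 ^ multiplicity p q"
    by (rule of_nat_less_two_power)
  also have "\<dots> \<le> p ^ multiplicity p q"
    using prime_ge_2_int[OF assms(1)] by (intro power_mono) auto
  also have "\<dots> \<le> \<bar>q\<bar>"
    using assms(2) by (intro zdvd_imp_le) (simp_all add: multiplicity_dvd)
  finally show ?thesis by simp
qed

text \<open>Compares \<open>P\<close>-adic neighbourhoods of zero with the subgroups \<open>q \<int>\<close>: the exponent \<open>\<bar>q\<bar>\<close>
  is at least the multiplicity of any prime in \<open>q\<close>.\<close>

lemma dvd_if_prime_powers_dvd: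
  fixes q :: int
  assumes "q \<noteq> 0"
  shows "\<exists>K. \<forall>j. (\<forall>p. prime p \<and> int p dvd q \<longrightarrow> int (p ^ K) dvd j) \<longrightarrow> q dvd j"
proof (intro exI allI impI)
  fix j assume j: "\<forall>p. prime p \<and> int p dvd q \<longrightarrow> int (p ^ nat \<bar>q\<bar>) dvd j"
  show "q dvd j"
  proof (cases "j = 0")
    case False
    show ?thesis
    proof (rule multiplicity_le_imp_dvd[OF assms])
      fix p :: int assume p: "prime p"
      show "multiplicity p q \<le> multiplicity p j"
      proof (cases "p dvd q")
        case True
        obtain p' where p': "p = int p'"
          using prime_ge_0_int[OF p] by (rule nonneg_int_cases)
        have "p ^ nat \<bar>q\<bar> dvd j"
          using j True p unfolding p' prime_nat_int_transfer by simp
        then have "nat \<bar>q\<bar> \<le> multiplicity p j"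
          using False p by (intro multiplicity_geI) auto
        moreover have "multiplicity p q \<le> nat \<bar>q\<bar>"
          using multiplicity_le_abs[OF _ assms] p by simp
        ultimately show ?thesis by simp
      next
        case False
        then show ?thesis by (simp add: not_dvd_imp_multiplicity_0)
      qed
    qed
  qed simp
qed

text \<open>A factor \<open>d\<close> absorbs at most \<open>d\<close> factors of a prime.\<close>

lemma prime_power_dvd_cancel:
  fixes p :: nat and d j :: int
  assumes p: "prime p" and d_pos: "0 < d" and dvd: "int (p ^ (K + nat d)) dvd d * j"
  shows "int (p ^ K) dvd j"
proof (cases "j = 0")
  case False
  have p': "prime_elem (int p)" "\<not> is_unit (int p)" 
    using p by (auto simp: prime_imp_prime_elem)
  have "multiplicity (int p) d \<le> nat d"
    using multiplicity_le_abs[of "int p" d] p d_pos by simp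
  moreover have "K + nat d \<le> multiplicity (int p) (d * j)"
    using dvd p'(2) False d_pos by (simp add: power_dvd_iff_le_multiplicity)
  moreover have "multiplicity (int p) (d * j) = multiplicity (int p) d + multiplicity (int p) j"
    using False d_pos by (intro prime_elem_multiplicity_mult_distrib p'(1)) auto
  ultimately have "K \<le> multiplicity (int p) j" by simp
  then show ?thesis
    using p'(2) False by (simp add: power_dvd_iff_le_multiplicity)
qed simp

section \<open>The affine representation of a Baumslag--Solitar group\<close>

text \<open>An assignment of maps to letters respecting inverses and relations represents the presented group;
  a word acts by folding its letters, so its rightmost letter acts first.\<close>

lemma pres_eq_foldr:
  assumes inv: "\<And>x b. f (x, b) \<circ> f (x, \<not> b) = id"
    and rels: "\<And>u v. (u, v) \<in> R \<Longrightarrow> foldr f u = foldr f v"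
    and "pres_eq R u v"
  shows "foldr f u = foldr f v"
  using \<open>pres_eq R u v\<close>
proof induction
  case (cancel p x b q)
  have "f (x, b) (f (x, \<not> b) y) = y" for y
    using fun_cong[OF inv[of x b], of y] by simp
  then show ?case by (simp add: fun_eq_iff)
next
  case (rel u v p q)
  then show ?case by (simp add: rels fun_eq_iff)
qed simp_all

text \<open>The relation holds since \<open>(n / m) ((m / n) x + m) = x + n\<close>.\<close>

fun BS_affine :: "int \<Rightarrow> int \<Rightarrow> bs_gen \<times> bool \<Rightarrow> rat \<Rightarrow> rat" where
  "BS_affine m n (gen_a, b) x = (if b then x - 1 else x + 1)"
| "BS_affine m n (gen_t, b) x =
    (if b then of_int m / of_int n * x else of_int n / of_int m * x)"

lemma foldr_BS_affine_a:
  "foldr (BS_affine m n) (word_pow gen_a k) x = x + of_int k"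
proof -
  have "foldr (BS_affine m n) (replicate l (gen_a, b)) x = x + (if b then - of_nat l else of_nat l)" for l b
    by (induction l) auto
  then show ?thesis by (simp add: word_pow_def)
qed

lemma foldr_BS_affine_t:
  "foldr (BS_affine m n) (replicate l (gen_t, False)) x = (of_int n / of_int m) ^ l * x"
  "foldr (BS_affine m n) (replicate l (gen_t, True)) x = (of_int m / of_int n) ^ l * x"
  by (induction l) auto

lemma foldr_BS_affine_cong:
  assumes "m \<noteq> 0" "n \<noteq> 0" and "pres_eq (BS_rels m n) u v"
  shows "foldr (BS_affine m n) u = foldr (BS_affine m n) v"
proof (rule pres_eq_foldr[OF _ _ assms(3)])
  show "BS_affine m n (x, b) \<circ> BS_affine m n (x, \<not> b) = id" for x b
    using assms(1,2) by (cases x) (auto simp: fun_eq_iff)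
  show "foldr (BS_affine m n) u = foldr (BS_affine m n) v" if "(u, v) \<in> BS_rels m n" for u v
    using that assms(1,2)
    by (auto simp: BS_rels_def fun_eq_iff foldr_BS_affine_a field_simps)
qed

text \<open>Clearing denominators gives \<open>k B^L = C^L j\<close>, and \<open>C^L\<close> is coprime to \<open>B^L\<close>.\<close>

lemma int_dvd_if_power_ratio_eq:
  fixes B C :: int
  assumes "coprime B C" and "B \<noteq> 0" and "of_int k = (of_int C / of_int B) ^ L * (of_int j :: rat)"
  shows "C ^ L dvd k"
proof -
  have "of_int (k * B ^ L) = (of_int (C ^ L * j) :: rat)"
    using assms(2,3) by (simp add: power_divide)
  then have "k * B ^ L = C ^ L * j"
    unfolding of_int_eq_iff .
  then have "C ^ L dvd k * B ^ L" by simp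
  moreover have "coprime (C ^ L) (B ^ L)"
    using \<open>coprime B C\<close> by (simp add: coprime_commute)
  ultimately show ?thesis
    using coprime_dvd_mult_left_iff by blast
qed

section \<open>Stabilisers of cosets in the Baumslag--Solitar group\<close>

locale BS_closure_action =
  fixes m n :: int
  assumes m_nz: "m \<noteq> 0" and n_nz: "n \<noteq> 0"
begin

abbreviation G where "G \<equiv> BS m n"

sublocale group G by (rule group_BS)

definition d where "d = gcd m n"
definition M where "M = m div d"
definition N where "N = n div d"

abbreviation a where "a \<equiv> BS_a m n"
abbreviation t where "t \<equiv> BS_t m n"
abbreviation S where "S \<equiv> BS_cosets m n"
abbreviation base where "base \<equiv> BS_A m n"

definition \<alpha> :: "int \<Rightarrow> bs_gen gword set set \<Rightarrow> bs_gen gword set set" where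
  "\<alpha> k = BS_action m n (a [^]\<^bsub>G\<^esub> k)"

lemma d_pos: "0 < d"
  using m_nz by (simp add: d_def)

lemma m_eq: "m = d * M" and n_eq: "n = d * N"
  by (simp_all add: d_def M_def N_def)

lemma M_nz: "M \<noteq> 0" and N_nz: "N \<noteq> 0"
  using m_eq n_eq m_nz n_nz by auto

lemma coprime_M_N: "coprime M N"
  unfolding M_def N_def d_def using m_nz by (intro div_gcd_coprime) simp

lemma a_closed [simp]: "a \<in> carrier G" and t_closed [simp]: "t \<in> carrier G"
  by (rule BS_a_closed BS_t_closed)+

lemma subgroup_base: "subgroup base G"
  unfolding BS_A_def by (rule generate_is_subgroup) simp

lemma base_eq: "base = range (\<lambda>k::int. a [^]\<^bsub>G\<^esub> k)"
  unfolding BS_A_def generate_pow[OF a_closed] by blast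

lemma coset_mem: "g \<in> carrier G \<Longrightarrow> g <#\<^bsub>G\<^esub> base \<in> S"
  by (auto simp: BS_cosets_def LCOSETS_def)

lemma cosetE:
  assumes "c \<in> S" obtains g where "g \<in> carrier G" "c = g <#\<^bsub>G\<^esub> base"
  using assms by (auto simp: BS_cosets_def LCOSETS_def)

text \<open>Fixing a coset means that moving past its representative results in a power of \<open>a\<close>. This form, rather
  than conjugation by \<open>g\<close>, can be read off from words.\<close>

lemma BS_action_fixes_iff:
  assumes g: "g \<in> carrier G" and x: "x \<in> carrier G"
  shows "BS_action m n x (g <#\<^bsub>G\<^esub> base) = g <#\<^bsub>G\<^esub> base \<longleftrightarrow>
    (\<exists>j::int. x \<otimes>\<^bsub>G\<^esub> g = g \<otimes>\<^bsub>G\<^esub> a [^]\<^bsub>G\<^esub> j)"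
proof -
  have xg: "x \<otimes>\<^bsub>G\<^esub> g \<in> carrier G" using g x by simp
  have "BS_action m n x (g <#\<^bsub>G\<^esub> base) = (x \<otimes>\<^bsub>G\<^esub> g) <#\<^bsub>G\<^esub> base"
    using coset_mem[OF g] lcos_m_assoc[OF BS_A_subset x g] by (simp add: BS_action_def)
  moreover have "(x \<otimes>\<^bsub>G\<^esub> g) <#\<^bsub>G\<^esub> base = g <#\<^bsub>G\<^esub> base \<longleftrightarrow> x \<otimes>\<^bsub>G\<^esub> g \<in> g <#\<^bsub>G\<^esub> base"
    using lcos_self[OF xg subgroup_base] l_repr_independence[OF _ g subgroup_base] by metis
  ultimately show ?thesis
    by (auto simp: l_coset_def base_eq)
qed

lemma \<alpha>_fixes_iff:
  assumes "g \<in> carrier G"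
  shows "\<alpha> k (g <#\<^bsub>G\<^esub> base) = g <#\<^bsub>G\<^esub> base \<longleftrightarrow>
    (\<exists>j::int. a [^]\<^bsub>G\<^esub> k \<otimes>\<^bsub>G\<^esub> g = g \<otimes>\<^bsub>G\<^esub> a [^]\<^bsub>G\<^esub> j)"
  unfolding \<alpha>_def using assms by (intro BS_action_fixes_iff) simp_all

sublocale int_action S \<alpha>
proof
  have "(\<lambda>k::int. a [^]\<^bsub>G\<^esub> k) \<in> hom integer_group G"
    by (rule hom_integer_group_pow) simp
  then have "BS_action m n \<circ> (\<lambda>k::int. a [^]\<^bsub>G\<^esub> k) \<in> hom integer_group (BijGroup S)"
    using hom_BS_action by (rule Group.hom_compose)
  then show "\<alpha> \<in> hom integer_group (BijGroup S)"
    by (simp add: \<alpha>_def[abs_def] o_def)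
qed

lemma range_\<alpha>: "range \<alpha> = BS_action m n ` base"
  by (auto simp: \<alpha>_def base_eq)

lemma t_conj_power: "t \<otimes>\<^bsub>G\<^esub> a [^]\<^bsub>G\<^esub> (m * i) = a [^]\<^bsub>G\<^esub> (n * i) \<otimes>\<^bsub>G\<^esub> t" for i :: int
proof -
  let ?c = "\<lambda>x. t \<otimes>\<^bsub>G\<^esub> x \<otimes>\<^bsub>G\<^esub> inv\<^bsub>G\<^esub> t"
  have c: "?c \<in> hom G G"
  proof (rule homI)
    fix x y assume "x \<in> carrier G" "y \<in> carrier G"
    moreover from this have "inv\<^bsub>G\<^esub> t \<otimes>\<^bsub>G\<^esub> (t \<otimes>\<^bsub>G\<^esub> (y \<otimes>\<^bsub>G\<^esub> inv\<^bsub>G\<^esub> t)) = y \<otimes>\<^bsub>G\<^esub> inv\<^bsub>G\<^esub> t"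
      by (simp flip: m_assoc)
    ultimately show "?c (x \<otimes>\<^bsub>G\<^esub> y) = ?c x \<otimes>\<^bsub>G\<^esub> ?c y"
      by (simp add: m_assoc)
  qed simp
  interpret c: group_hom G G ?c
    by (intro group_hom.intro group_hom_axioms.intro is_group c)
  have "?c (a [^]\<^bsub>G\<^esub> (m * i)) = ?c (a [^]\<^bsub>G\<^esub> m) [^]\<^bsub>G\<^esub> i"
    by (simp add: c.hom_int_pow int_pow_pow[symmetric])
  also have "?c (a [^]\<^bsub>G\<^esub> m) = a [^]\<^bsub>G\<^esub> n"
    by (rule BS_relation)
  also have "(a [^]\<^bsub>G\<^esub> n) [^]\<^bsub>G\<^esub> i = a [^]\<^bsub>G\<^esub> (n * i)"
    by (simp add: int_pow_pow)
  finally have "?c (a [^]\<^bsub>G\<^esub> (m * i)) \<otimes>\<^bsub>G\<^esub> t = a [^]\<^bsub>G\<^esub> (n * i) \<otimes>\<^bsub>G\<^esub> t"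
    by simp
  then show ?thesis by (simp add: m_assoc)
qed

lemma tinv_conj_power: "inv\<^bsub>G\<^esub> t \<otimes>\<^bsub>G\<^esub> a [^]\<^bsub>G\<^esub> (n * i) = a [^]\<^bsub>G\<^esub> (m * i) \<otimes>\<^bsub>G\<^esub> inv\<^bsub>G\<^esub> t" for i :: int
proof -
  have "a [^]\<^bsub>G\<^esub> (m * i) = inv\<^bsub>G\<^esub> t \<otimes>\<^bsub>G\<^esub> (t \<otimes>\<^bsub>G\<^esub> a [^]\<^bsub>G\<^esub> (m * i))"
    by (simp flip: m_assoc)
  also have "\<dots> = inv\<^bsub>G\<^esub> t \<otimes>\<^bsub>G\<^esub> a [^]\<^bsub>G\<^esub> (n * i) \<otimes>\<^bsub>G\<^esub> t"
    by (simp add: t_conj_power m_assoc)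
  finally show ?thesis by (simp add: m_assoc)
qed

text \<open>Powers of \<open>a\<close> can be moved past \<open>g\<close> provided that they are deep enough, and they stay as deep as
  required. The claim about \<open>j\<close> makes the property closed under products, hence provable letter by letter.\<close>

definition conj_deep_powers :: "bs_gen gword set \<Rightarrow> bool" where
  "conj_deep_powers g \<longleftrightarrow> (\<forall>s. \<exists>r. \<forall>k. d * (M * N) ^ r dvd k \<longrightarrow>
    (\<exists>j. d * (M * N) ^ s dvd j \<and> a [^]\<^bsub>G\<^esub> (k::int) \<otimes>\<^bsub>G\<^esub> g = g \<otimes>\<^bsub>G\<^esub> a [^]\<^bsub>G\<^esub> (j::int)))"

lemma conj_deep_powers_mult:
  assumes g: "g \<in> carrier G" "conj_deep_powers g" and h: "h \<in> carrier G" "conj_deep_powers h"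
  shows "conj_deep_powers (g \<otimes>\<^bsub>G\<^esub> h)"
  unfolding conj_deep_powers_def
proof
  fix s
  obtain r' where r': "\<And>k. d * (M * N) ^ r' dvd k \<Longrightarrow>
      \<exists>j. d * (M * N) ^ s dvd j \<and> a [^]\<^bsub>G\<^esub> k \<otimes>\<^bsub>G\<^esub> h = h \<otimes>\<^bsub>G\<^esub> a [^]\<^bsub>G\<^esub> j"
    using h(2) unfolding conj_deep_powers_def by blast
  obtain r where r: "\<And>k. d * (M * N) ^ r dvd k \<Longrightarrow>
      \<exists>j. d * (M * N) ^ r' dvd j \<and> a [^]\<^bsub>G\<^esub> k \<otimes>\<^bsub>G\<^esub> g = g \<otimes>\<^bsub>G\<^esub> a [^]\<^bsub>G\<^esub> j"
    using g(2) unfolding conj_deep_powers_def by blast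
  have "\<exists>j. d * (M * N) ^ s dvd j \<and>
      a [^]\<^bsub>G\<^esub> k \<otimes>\<^bsub>G\<^esub> (g \<otimes>\<^bsub>G\<^esub> h) = g \<otimes>\<^bsub>G\<^esub> h \<otimes>\<^bsub>G\<^esub> a [^]\<^bsub>G\<^esub> j" if k: "d * (M * N) ^ r dvd k" for k
  proof -
    obtain i where i: "d * (M * N) ^ r' dvd i" "a [^]\<^bsub>G\<^esub> k \<otimes>\<^bsub>G\<^esub> g = g \<otimes>\<^bsub>G\<^esub> a [^]\<^bsub>G\<^esub> i"
      using r[OF k] by blast
    obtain j where j: "d * (M * N) ^ s dvd j" "a [^]\<^bsub>G\<^esub> i \<otimes>\<^bsub>G\<^esub> h = h \<otimes>\<^bsub>G\<^esub> a [^]\<^bsub>G\<^esub> j"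
      using r'[OF i(1)] by blast
    have "a [^]\<^bsub>G\<^esub> k \<otimes>\<^bsub>G\<^esub> (g \<otimes>\<^bsub>G\<^esub> h) = (a [^]\<^bsub>G\<^esub> k \<otimes>\<^bsub>G\<^esub> g) \<otimes>\<^bsub>G\<^esub> h"
      using g h by (simp add: m_assoc)
    also have "\<dots> = g \<otimes>\<^bsub>G\<^esub> (a [^]\<^bsub>G\<^esub> i \<otimes>\<^bsub>G\<^esub> h)"
      using g h i by (simp add: m_assoc)
    also have "\<dots> = g \<otimes>\<^bsub>G\<^esub> h \<otimes>\<^bsub>G\<^esub> a [^]\<^bsub>G\<^esub> j"
      using g h j by (simp add: m_assoc)
    finally show ?thesis using j(1) by blast
  qed
  then show "\<exists>r. \<forall>k. d * (M * N) ^ r dvd k \<longrightarrow> (\<exists>j. d * (M * N) ^ s dvd j \<and>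
      a [^]\<^bsub>G\<^esub> k \<otimes>\<^bsub>G\<^esub> (g \<otimes>\<^bsub>G\<^esub> h) = g \<otimes>\<^bsub>G\<^esub> h \<otimes>\<^bsub>G\<^esub> a [^]\<^bsub>G\<^esub> j)"
    by blast
qed

lemma conj_deep_powers_power_a: "conj_deep_powers (a [^]\<^bsub>G\<^esub> (l::int))"
  unfolding conj_deep_powers_def by (metis a_closed add.commute int_pow_mult)

text \<open>For a letter \<open>t\<close> or its inverse, one factor \<open>M * N\<close> of the exponent pays for the move.\<close>

lemma conj_deep_powers_if_relation:
  assumes "\<And>i::int. g \<otimes>\<^bsub>G\<^esub> a [^]\<^bsub>G\<^esub> (d * B * i) = a [^]\<^bsub>G\<^esub> (d * C * i) \<otimes>\<^bsub>G\<^esub> g" and "C dvd M * N"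
  shows "conj_deep_powers g"
  unfolding conj_deep_powers_def
proof
  fix s
  have "\<exists>j. d * (M * N) ^ s dvd j \<and> a [^]\<^bsub>G\<^esub> k \<otimes>\<^bsub>G\<^esub> g = g \<otimes>\<^bsub>G\<^esub> a [^]\<^bsub>G\<^esub> j"
    if k: "d * (M * N) ^ Suc s dvd k" for k
  proof -
    obtain e where e: "M * N = C * e" using \<open>C dvd M * N\<close> by (rule dvdE)
    obtain f where f: "k = d * (M * N) ^ Suc s * f" using k by (rule dvdE)
    have "k = d * C * (e * (M * N) ^ s * f)"
      by (simp add: f e mult_ac)
    then have "a [^]\<^bsub>G\<^esub> k \<otimes>\<^bsub>G\<^esub> g = g \<otimes>\<^bsub>G\<^esub> a [^]\<^bsub>G\<^esub> (d * B * (e * (M * N) ^ s * f))"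
      using assms(1) by simp
    moreover have "d * (M * N) ^ s dvd d * B * (e * (M * N) ^ s * f)"
      by (rule dvdI[where k = "B * e * f"]) (simp add: mult_ac)
    ultimately show ?thesis by blast
  qed
  then show "\<exists>r. \<forall>k. d * (M * N) ^ r dvd k \<longrightarrow>
      (\<exists>j. d * (M * N) ^ s dvd j \<and> a [^]\<^bsub>G\<^esub> k \<otimes>\<^bsub>G\<^esub> g = g \<otimes>\<^bsub>G\<^esub> a [^]\<^bsub>G\<^esub> j)"
    by blast
qed

lemma conj_deep_powers_letter: "conj_deep_powers (pres_class (BS_rels m n) [(x, b)])"
proof (cases x)
  case gen_a
  have "pres_class (BS_rels m n) [(gen_a, b)] = (if b then inv\<^bsub>G\<^esub> a else a)"
    using pres_class_inv_gen[of "BS_rels m n" gen_a False]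
    by (simp add: BS_a_def BS_def)
  also have "\<dots> = a [^]\<^bsub>G\<^esub> (if b then - 1 else 1 :: int)"
    using int_pow_neg[OF a_closed, of 1] int_pow_1[OF a_closed] by simp
  finally have "pres_class (BS_rels m n) [(gen_a, b)] = a [^]\<^bsub>G\<^esub> (if b then - 1 else 1 :: int)" .
  then show ?thesis using conj_deep_powers_power_a gen_a by simp
next
  case gen_t
  have "conj_deep_powers t"
    using conj_deep_powers_if_relation[of t M N] t_conj_power by (simp add: m_eq[symmetric] n_eq[symmetric])
  moreover have "conj_deep_powers (inv\<^bsub>G\<^esub> t)"
    using conj_deep_powers_if_relation[of "inv\<^bsub>G\<^esub> t" N M] tinv_conj_power by (simp add: m_eq[symmetric] n_eq[symmetric])
  moreover have "pres_class (BS_rels m n) [(gen_t, b)] = (if b then inv\<^bsub>G\<^esub> t else t)"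
    using pres_class_inv_gen[of "BS_rels m n" gen_t False]
    by (simp add: BS_t_def BS_def)
  ultimately show ?thesis using gen_t by simp
qed

lemma conj_deep_powers: "g \<in> carrier G \<Longrightarrow> conj_deep_powers g"
proof -
  have "conj_deep_powers (pres_class (BS_rels m n) u)" for u
  proof (induction u)
    case Nil
    show ?case
      using conj_deep_powers_power_a[of 0] by (simp add: BS_def one_presented_group)
  next
    case (Cons l u)
    obtain x b where l: "l = (x, b)" by fastforce
    have "conj_deep_powers (pres_class (BS_rels m n) [l] \<otimes>\<^bsub>G\<^esub> pres_class (BS_rels m n) u)"
      using Cons conj_deep_powers_letter[of x b]
      by (intro conj_deep_powers_mult) (simp_all add: l BS_def carrier_presented_group)
    then show ?case
      by (simp add: BS_def mult_presented_group)
  qed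
  then show "conj_deep_powers g" if "g \<in> carrier G"
    using that by (auto simp: BS_def carrier_presented_group)
qed

lemma ex_power_fixing:
  assumes "c \<in> S"
  obtains r where "\<And>k. d * (M * N) ^ r dvd k \<Longrightarrow> \<alpha> k c = c"
proof -
  obtain g where g: "g \<in> carrier G" "c = g <#\<^bsub>G\<^esub> base"
    using assms by (rule cosetE)
  show ?thesis
    using conj_deep_powers[OF g(1)] that unfolding conj_deep_powers_def g(2) \<alpha>_fixes_iff[OF g(1)] by metis
qed

text \<open>The lower bound on the index of the stabilisers. If \<open>a^k\<close> moves past \<open>t^L\<close> to become \<open>a^j\<close>, then
  applying both sides to \<open>0\<close> in the affine representation gives \<open>k = (N / M)^L j\<close>.\<close>

lemma fixes_t_coset:
  defines "T \<equiv> \<lambda>b L. pres_class (BS_rels m n) (replicate L (gen_t, b))"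
  shows "\<alpha> k (T False L <#\<^bsub>G\<^esub> base) = T False L <#\<^bsub>G\<^esub> base \<Longrightarrow> N ^ L dvd k"
    and "\<alpha> k (T True L <#\<^bsub>G\<^esub> base) = T True L <#\<^bsub>G\<^esub> base \<Longrightarrow> M ^ L dvd k"
proof -
  have T: "T b L \<in> carrier G" for b
    by (simp add: T_def BS_def carrier_presented_group)
  have eval: "\<exists>j. of_int k = foldr (BS_affine m n) (replicate L (gen_t, b)) (of_int j) - foldr (BS_affine m n) (replicate L (gen_t, b)) 0"
    if fixed: "\<alpha> k (T b L <#\<^bsub>G\<^esub> base) = T b L <#\<^bsub>G\<^esub> base" for b
  proof -
    obtain j :: int where "a [^]\<^bsub>G\<^esub> k \<otimes>\<^bsub>G\<^esub> T b L = T b L \<otimes>\<^bsub>G\<^esub> a [^]\<^bsub>G\<^esub> j"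
      using fixed unfolding \<alpha>_fixes_iff[OF T] by blast
    then have "pres_eq (BS_rels m n) (word_pow gen_a k @ replicate L (gen_t, b)) (replicate L (gen_t, b) @ word_pow gen_a j)"
      by (simp add: T_def BS_def BS_a_def mult_presented_group pres_class_eq_iff flip: pres_class_word_pow)
    then have "foldr (BS_affine m n) (word_pow gen_a k @ replicate L (gen_t, b)) 0 =
        foldr (BS_affine m n) (replicate L (gen_t, b) @ word_pow gen_a j) 0"
      using foldr_BS_affine_cong[OF m_nz n_nz] by simp
    then have "foldr (BS_affine m n) (replicate L (gen_t, b)) 0 + of_int k =
        foldr (BS_affine m n) (replicate L (gen_t, b)) (of_int j)"
      by (simp add: foldr_BS_affine_a)
    then show ?thesis by (intro exI[of _ j]) simp
  qed
  have ratio: "of_int n / of_int m = (of_int N / of_int M :: rat)" "of_int m / of_int n = (of_int M / of_int N :: rat)"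
  proof -
    have "(of_int m :: rat) = of_int d * of_int M" "(of_int n :: rat) = of_int d * of_int N"
      using m_eq n_eq by (metis of_int_mult)+
    moreover have "(of_int d :: rat) \<noteq> 0" using d_pos by simp
    ultimately show "of_int n / of_int m = (of_int N / of_int M :: rat)"
        "of_int m / of_int n = (of_int M / of_int N :: rat)"
      by (metis mult_divide_mult_cancel_left)+
  qed
  show "N ^ L dvd k" if fixed: "\<alpha> k (T False L <#\<^bsub>G\<^esub> base) = T False L <#\<^bsub>G\<^esub> base"
  proof -
    obtain j where "of_int k = (of_int N / of_int M) ^ L * (of_int j :: rat)"
      using eval[OF fixed] unfolding foldr_BS_affine_t ratio mult_zero_right diff_zero by blast
    then show ?thesis by (rule int_dvd_if_power_ratio_eq[OF coprime_M_N M_nz])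
  qed
  show "M ^ L dvd k" if fixed: "\<alpha> k (T True L <#\<^bsub>G\<^esub> base) = T True L <#\<^bsub>G\<^esub> base"
  proof -
    obtain j where "of_int k = (of_int M / of_int N) ^ L * (of_int j :: rat)"
      using eval[OF fixed] unfolding foldr_BS_affine_t ratio mult_zero_right diff_zero by blast
    moreover have "coprime N M" using coprime_M_N by (simp add: coprime_commute)
    ultimately show ?thesis using N_nz by (intro int_dvd_if_power_ratio_eq)
  qed
qed

definition P where "P = {p::nat. prime p \<and> int p dvd M * N}"

text \<open>Up to sign, \<open>lcm m n div m\<close> is \<open>N\<close> and \<open>lcm m n div n\<close> is \<open>M\<close>.\<close>

lemma P_eq: "P = {p. prime p \<and> (int p dvd lcm m n div m \<or> int p dvd lcm m n div n)}"
proof -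
  have lcm: "\<bar>m\<bar> * \<bar>n\<bar> = d * lcm m n"
    unfolding d_def by (rule prod_gcd_lcm_int)
  have abs_lcm_div_m: "\<bar>lcm m n div m\<bar> = \<bar>N\<bar>"
  proof -
    have "d * \<bar>m\<bar> * \<bar>lcm m n div m\<bar> = d * lcm m n"
      by (simp flip: abs_mult)
    also have "\<dots> = \<bar>m\<bar> * (d * \<bar>N\<bar>)"
      using d_pos lcm by (metis abs_mult abs_of_pos n_eq)
    finally show ?thesis using m_nz d_pos by simp
  qed
  have abs_lcm_div_n: "\<bar>lcm m n div n\<bar> = \<bar>M\<bar>"
  proof -
    have "d * \<bar>n\<bar> * \<bar>lcm m n div n\<bar> = d * lcm m n"
      by (simp flip: abs_mult)
    also have "\<dots> = d * \<bar>M\<bar> * \<bar>n\<bar>"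
      using d_pos lcm by (metis abs_mult abs_of_pos m_eq)
    finally show ?thesis using n_nz d_pos by simp
  qed
  have "int p dvd lcm m n div m \<longleftrightarrow> int p dvd N" "int p dvd lcm m n div n \<longleftrightarrow> int p dvd M" for p
    using abs_lcm_div_m abs_lcm_div_n by (metis dvd_abs_iff)+
  then show ?thesis
    by (auto simp: P_def prime_dvd_mult_iff)
qed

lemma finite_P: "finite P"
proof (rule finite_subset)
  show "P \<subseteq> {..nat \<bar>M * N\<bar>}"
  proof
    fix p assume "p \<in> P"
    then have "int p \<le> \<bar>M * N\<bar>"
      using M_nz N_nz dvd_imp_le_int[of "M * N" "int p"] by (simp add: P_def)
    then show "p \<in> {..nat \<bar>M * N\<bar>}" by simp
  qed
qed simp

text \<open>Both bounds on stabilisers, restricted to the multiples of \<open>d\<close>: the factor \<open>d\<close> in the first one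
  disappears, and in the second one it costs a bounded power of each prime, which is compensated by
  taking \<open>L = K + d\<close>.\<close>

sublocale multiples: padic_int_action S "\<lambda>k. \<alpha> (d * k)" P
proof (intro padic_int_action.intro int_action_multiples padic_int_action_axioms.intro)
  show "finite P" by (rule finite_P)
  show "prime p" if "p \<in> P" for p
    using that by (simp add: P_def)
  show "\<exists>K. \<forall>j. (\<forall>p\<in>P. int (p ^ K) dvd j) \<longrightarrow> \<alpha> (d * j) c = c" if "c \<in> S" for c
  proof -
    obtain r where r: "\<And>k. d * (M * N) ^ r dvd k \<Longrightarrow> \<alpha> k c = c"
      using ex_power_fixing[OF \<open>c \<in> S\<close>] by blast
    have "(M * N) ^ r \<noteq> 0" using M_nz N_nz by simp
    then obtain K where K: "\<And>j. (\<And>p. prime p \<Longrightarrow> int p dvd (M * N) ^ r \<Longrightarrow> int (p ^ K) dvd j) \<Longrightarrow> (M * N) ^ r dvd j"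
      using dvd_if_prime_powers_dvd by metis
    have "\<alpha> (d * j) c = c" if j: "\<forall>p\<in>P. int (p ^ K) dvd j" for j
    proof -
      have "int (p ^ K) dvd j" if "prime p" "int p dvd (M * N) ^ r" for p
        using that j prime_dvd_power[of "int p" "M * N" r] by (simp add: P_def)
      then have "(M * N) ^ r dvd j" by (rule K)
      then show ?thesis by (intro r mult_dvd_mono dvd_refl)
    qed
    then show ?thesis by blast
  qed
  show "\<exists>F. finite F \<and> F \<subseteq> S \<and>
      (\<forall>j. (\<forall>c\<in>F. \<alpha> (d * j) c = c) \<longrightarrow> (\<forall>p\<in>P. int (p ^ K) dvd j))" for K
  proof -
    define L where "L = K + nat d"
    define c where "c b = pres_class (BS_rels m n) (replicate L (gen_t, b)) <#\<^bsub>G\<^esub> base" for b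
    have "c b \<in> S" for b
      unfolding c_def by (rule coset_mem) (simp add: BS_def carrier_presented_group)
    moreover have "int (p ^ K) dvd j" if fixed: "\<forall>c\<in>{c False, c True}. \<alpha> (d * j) c = c" and p: "p \<in> P" for j p
    proof -
      have "N ^ L dvd d * j" "M ^ L dvd d * j"
        using fixed fixes_t_coset unfolding c_def by simp_all
      moreover have "prime p" "int p dvd M \<or> int p dvd N"
        using p prime_dvd_mult_iff[of "int p" M N] by (simp_all add: P_def)
      ultimately have "int p ^ L dvd d * j"
        by (meson dvd_power_same dvd_trans)
      then have "int (p ^ (K + nat d)) dvd d * j"
        unfolding L_def of_nat_power .
      then show ?thesis
        by (rule prime_power_dvd_cancel[OF \<open>prime p\<close> d_pos])
    qed
    ultimately show ?thesis
      by (intro exI[of _ "{c False, c True}"] conjI allI impI ballI) simp_all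
  qed
qed

section \<open>The closure of the cyclic subgroup as an open subgroup\<close>

lemma carrier_BS_closure:
  "carrier (BS_closure m n) = Abstract_Topology.closure_of (sym_topology S) (BS_action m n ` carrier G)"
  by (simp add: BS_closure_def)

lemma range_closure_subset: "range_closure \<subseteq> carrier (BS_closure m n)"
  unfolding carrier_BS_closure range_closure_def range_\<alpha>
  by (intro closure_of_mono image_mono BS_A_subset)

lemma BS_A_closure_eq: "BS_A_closure m n = range_closure"
proof -
  have "range \<alpha> \<subseteq> carrier (BS_closure m n)"
    using range_subset_range_closure range_closure_subset by simp
  then have "BS_A_closure m n = carrier (BS_closure m n) \<inter> range_closure"
    unfolding BS_A_closure_def BS_closure_topology_def closure_of_subtopology range_closure_def range_\<alpha>
    by (simp add: inf_absorb2)
  then show ?thesis using range_closure_subset by blast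
qed

lemma base_mem: "base \<in> S"
  using coset_mem[OF one_closed] lcos_mult_one[OF BS_A_subset] by simp

text \<open>If a limit \<open>x\<close> of group elements fixes \<open>\<langle>a\<rangle>\<close>, then so do the group elements that agree with \<open>x\<close>
  on a finite set containing this coset; they are then powers of \<open>a\<close>.\<close>

lemma range_closure_eq_stabilizer: "range_closure = {x \<in> carrier (BS_closure m n). x base = base}"
proof (rule antisym)
  have fixes_base: "BS_action m n g base = base \<longleftrightarrow> g \<in> base" if "g \<in> carrier G" for g
    using BS_action_fixes_iff[OF one_closed that] that lcos_mult_one[OF BS_A_subset]
    by (auto simp: base_eq)
  show "range_closure \<subseteq> {x \<in> carrier (BS_closure m n). x base = base}"
  proof
    fix x assume x: "x \<in> range_closure"
    then obtain k where "\<alpha> k base = x base"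
      using base_mem unfolding mem_range_closure_iff by (metis finite.intros empty_subsetI insert_subset insertI1)
    moreover have "\<alpha> k base = base"
      unfolding \<alpha>_def using fixes_base base_eq by (metis a_closed int_pow_closed rangeI)
    ultimately show "x \<in> {x \<in> carrier (BS_closure m n). x base = base}"
      using x range_closure_subset by auto
  qed
  show "{x \<in> carrier (BS_closure m n). x base = base} \<subseteq> range_closure"
  proof
    fix x assume x: "x \<in> {x \<in> carrier (BS_closure m n). x base = base}"
    have sub: "BS_action m n ` carrier G \<subseteq> Bij S"
      using hom_BS_action by (auto simp: hom_def BijGroup_def)
    have xB: "x \<in> Bij S"
      and approx: "\<And>F. finite F \<Longrightarrow> F \<subseteq> S \<Longrightarrow> \<exists>g\<in>carrier G. \<forall>c\<in>F. BS_action m n g c = x c"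
      using x unfolding carrier_BS_closure mem_Collect_eq in_closure_sym_topology_iff[OF sub] by simp_all
    have "\<exists>k. \<forall>c\<in>F. \<alpha> k c = x c" if F: "finite F" "F \<subseteq> S" for F
    proof -
      obtain g where g: "g \<in> carrier G" "\<forall>c\<in>insert base F. BS_action m n g c = x c"
        using approx[of "insert base F"] F base_mem by auto
      then have "g \<in> base"
        using x fixes_base[OF g(1)] by simp
      then obtain k :: int where "g = a [^]\<^bsub>G\<^esub> k"
        unfolding base_eq by blast
      then show ?thesis
        using g(2) unfolding \<alpha>_def by blast
    qed
    then show "x \<in> range_closure"
      unfolding mem_range_closure_iff using xB by blast
  qed
qed

lemma openin_range_closure: "openin (BS_closure_topology m n) range_closure"
proof -
  have "openin (sym_topology S) {x \<in> Bij S. x base = base}"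
    unfolding openin_sym_topology_iff using base_mem by (auto intro!: exI[of _ "{base}"])
  moreover have "carrier (BS_closure m n) \<subseteq> Bij S"
    unfolding carrier_BS_closure using closure_of_subset_topspace topspace_sym_topology by metis
  then have "range_closure = {x \<in> Bij S. x base = base} \<inter> carrier (BS_closure m n)"
    unfolding range_closure_eq_stabilizer by blast
  ultimately show ?thesis
    unfolding BS_closure_topology_def openin_subtopology by blast
qed

end

theorem proposition8p1:
  fixes m n :: int
  assumes "m \<noteq> 0" and "n \<noteq> 0"
  shows "subgroup (BS_A_closure m n) (BS_closure m n) \<and>
    compactin (BS_closure_topology m n) (BS_A_closure m n) \<and>
    openin (BS_closure_topology m n) (BS_A_closure m n) \<and>
    (\<exists>V. V \<lhd> (BS_closure m n)\<lparr>carrier := BS_A_closure m n\<rparr> \<and>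
      openin (subtopology (BS_closure_topology m n) (BS_A_closure m n)) V \<and>
      top_group_iso
        ((BS_closure m n)\<lparr>carrier := V\<rparr>)
        (subtopology (BS_closure_topology m n) V)
        (product_group
          {p. prime p \<and> (int p dvd lcm m n div m \<or> int p dvd lcm m n div n)} padic_int_group)
        (product_topology padic_int_topology
          {p. prime p \<and> (int p dvd lcm m n div m \<or> int p dvd lcm m n div n)}) \<and>
      finite (carrier ((BS_closure m n)\<lparr>carrier := BS_A_closure m n\<rparr> Mod V)) \<and>
      cyclic_group ((BS_closure m n)\<lparr>carrier := BS_A_closure m n\<rparr> Mod V) \<and>
      int (order ((BS_closure m n)\<lparr>carrier := BS_A_closure m n\<rparr> Mod V)) dvd gcd m n)"
proof -
  interpret BS_closure_action m n
    using assms by unfold_locales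
  let ?V = "multiples.range_closure"
  have V_iso: "compactin (sym_topology S) ?V"
      "top_group_iso ((BijGroup S)\<lparr>carrier := ?V\<rparr>) (subtopology (sym_topology S) ?V)
        (product_group P padic_int_group) (product_topology padic_int_topology P)"
    by (rule multiples.range_closure_iso_prod_padic_int)+
  note V = d_pos HOL.refl V_iso(1)
  have V_sub: "?V \<subseteq> range_closure" by (rule V_subset[OF V])
  have carrier_update: "(BS_closure m n)\<lparr>carrier := X\<rparr> = (BijGroup S)\<lparr>carrier := X\<rparr>" for X
    by (simp add: BS_closure_def)
  have topology: "subtopology (BS_closure_topology m n) X = subtopology (sym_topology S) X"
    if "X \<subseteq> range_closure" for X
  proof -
    have "carrier (BS_closure m n) \<inter> X = X"
      using that range_closure_subset by blast
    then show ?thesis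
      by (simp add: BS_closure_topology_def subtopology_subtopology)
  qed
  have subgroup_closure: "subgroup (carrier (BS_closure m n)) (BijGroup S)"
  proof -
    interpret group_hom G "BijGroup S" "BS_action m n"
      by (intro group_hom.intro group_hom_axioms.intro group_BS group_BijGroup hom_BS_action)
    show ?thesis
      unfolding carrier_BS_closure by (intro subgroup_closure_sym_topology img_is_subgroup)
  qed
  have "subgroup range_closure (BS_closure m n)"
    using group.subgroup_incl[OF group_BijGroup subgroup_range_closure subgroup_closure range_closure_subset]
    by (simp add: BS_closure_def)
  moreover have "compactin (BS_closure_topology m n) range_closure"
    unfolding BS_closure_topology_def compactin_subtopology
    using compactin_range_closure[OF V] range_closure_subset by blast
  moreover note openin_range_closure
  moreover have "?V \<lhd> (BijGroup S)\<lparr>carrier := range_closure\<rparr>"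
    by (rule V_normal[OF V])
  moreover have "openin (subtopology (sym_topology S) range_closure) ?V"
    by (rule V_open[OF V])
  moreover note V_iso(2) quotient_cyclic[OF V]
  ultimately show ?thesis
    unfolding BS_A_closure_eq carrier_update topology[OF order_refl] P_eq[symmetric] d_def[symmetric]
    unfolding topology[OF V_sub, symmetric]
    by (intro conjI exI[of _ ?V])
qed

end
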